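(* Let $p$ be a prime, $\alpha>1$, $\gamma\ge0$, and $a_n\in\mathbb{R}$ ($n\ge0$). Let $f:\mathbb{Q}_p\to[0,\infty)$ be locally integrable and satisfy $$f(x)\sim|x|_p^{-1}\sum_{n=0}^\infty a_n(\log|x|_p)^{\gamma-n},\qquad|x|_p\to\infty,$$ i.e. for every $N\ge0$, $f(x)-|x|_p^{-1}\sum_{n=0}^N a_n(\log|x|_p)^{\gamma-n}=o\bigl(|x|_p^{-1}(\log|x|_p)^{\gamma-N}\bigr)$ as $|x|_p\to\infty$. Then for every $N\ge0$, $$(I^\alpha f)(x)=\frac{1-p^{-\alpha}}{1-p^{\alpha-1}}\Bigl[|x|_p^{\alpha-1}\int_{|y|_p\le|x|_p}f(y)\,dy+|x|_p^{\alpha-1}\sum_{n=0}^N\widetilde B_n(\log|x|_p)^{\gamma-n}\Bigr]+o\bigl(|x|_p^{\alpha-1}(\log|x|_p)^{\gamma-N}\bigr),\qquad |x|_p\to\infty,$$ where $$\widetilde B_n=\sum_{k=0}^n a_{n-k}\binom{\gamma+k-n}{k}\widetilde\Omega(k,\alpha),\qquad\widetilde\Omega(k,\alpha)=\int_{|t|_p\le1}\bigl(|1-t|_p^{\alpha-1}-|t|_p^{\alpha-1}-1\bigr)|t|_p^{-1}(\log|t|_p)^k\,dt.$$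
   Context: $\mathbb{Q}_p$ is the field of $p$-adic numbers with the $p$-adic absolute value $|\cdot|_p$; $dy$ is the Haar measure on $\mathbb{Q}_p$ normalized so that $\int_{|y|_p\le1}dy=1$; $\log$ is the natural logarithm. For real $c$ and $k\in\mathbb{N}$, $\binom{c}{k}=\frac{c(c-1)\cdots(c-k+1)}{k!}$, and $\binom{c}{0}=1$. For $\alpha>1$ and locally integrable $f$, the $p$-adic fractional integration operator is $$(I^\alpha f)(x)=\frac{1-p^{-\alpha}}{1-p^{\alpha-1}}\int_{|y|_p\le|x|_p}\bigl(|x-y|_p^{\alpha-1}-|y|_p^{\alpha-1}\bigr)f(y)\,dy.$$ *)

theory Defs
  imports
    "HOL-Analysis.Analysis"
    "HOL-Library.Landau_Symbols"
    "Berlekamp_Zassenhaus.Finite_Field"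
begin

subsection \<open>The $p$-adic absolute value on the rationals\<close>

definition rat_padic_abs :: "nat \<Rightarrow> rat \<Rightarrow> real" where
  "rat_padic_abs p x =
     (if x = 0 then 0
      else real p powi (int (multiplicity (int p) (snd (quotient_of x)))
                        - int (multiplicity (int p) (fst (quotient_of x)))))"

lemma rat_padic_abs_0 [simp]: "rat_padic_abs p 0 = 0"
  by (simp add: rat_padic_abs_def)

lemma rat_padic_abs_1 [simp]: "rat_padic_abs p 1 = 1"
  by (simp add: rat_padic_abs_def)

lemma rat_padic_abs_frac:
  assumes p: "prime p" and a: "a \<noteq> 0" and b: "b \<noteq> 0"
  shows "rat_padic_abs p (of_int a / of_int b) =
           real p powi (int (multiplicity (int p) b) - int (multiplicity (int p) a))"
proof -
  obtain c d where cd: "quotient_of (of_int a / of_int b) = (c, d)"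
    by (cases "quotient_of (of_int a / of_int b)")
  have d: "d > 0"
    using cd quotient_of_denom_pos by blast
  have eq: "(of_int a / of_int b :: rat) = of_int c / of_int d"
    using cd quotient_of_div by blast
  have ne: "(of_int a / of_int b :: rat) \<noteq> 0"
    using a b by simp
  have c: "c \<noteq> 0"
    using eq ne by auto
  have "(of_int (a * d) :: rat) = of_int (c * b)"
    using eq b d by (simp add: field_simps)
  then have cross: "a * d = c * b"
    by (simp only: of_int_eq_iff)
  have pe: "prime_elem (int p)"
    using p by simp
  have "multiplicity (int p) a + multiplicity (int p) d
      = multiplicity (int p) c + multiplicity (int p) b"
    using prime_elem_multiplicity_mult_distrib[OF pe, of a d]
      prime_elem_multiplicity_mult_distrib[OF pe, of c b] cross a b c d by simp
  then have "int (multiplicity (int p) d) - int (multiplicity (int p) c)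
      = int (multiplicity (int p) b) - int (multiplicity (int p) a)"
    by linarith
  then show ?thesis
    using ne by (simp add: rat_padic_abs_def cd)
qed

lemma rat_frac_cases:
  fixes x :: rat
  assumes "x \<noteq> 0"
  obtains a b where "x = of_int a / of_int b" "a \<noteq> 0" "b \<noteq> 0"
proof -
  obtain a b where q: "quotient_of x = (a, b)"
    by (cases "quotient_of x")
  have "x = of_int a / of_int b" "b > 0"
    using q quotient_of_div quotient_of_denom_pos by blast+
  with that assms show ?thesis
    by (metis div_0 less_irrefl of_int_0)
qed

lemma rat_padic_abs_nonneg [simp]: "rat_padic_abs p x \<ge> 0"
  by (simp add: rat_padic_abs_def)

lemma rat_padic_abs_eq_0_iff:
  assumes "prime p"
  shows "rat_padic_abs p x = 0 \<longleftrightarrow> x = 0"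
  using prime_gt_0_nat[OF assms] by (simp add: rat_padic_abs_def)

lemma rat_padic_abs_minus [simp]:
  assumes "prime p"
  shows "rat_padic_abs p (- x) = rat_padic_abs p x"
proof (cases "x = 0")
  case False
  then obtain a b where ab: "x = of_int a / of_int b" "a \<noteq> 0" "b \<noteq> 0"
    by (rule rat_frac_cases)
  have "- x = of_int (- a) / of_int b"
    using ab by simp
  moreover have "multiplicity (int p) (- a) = multiplicity (int p) a"
    by (metis multiplicity_normalize_right normalize_int_def abs_minus_cancel)
  ultimately show ?thesis
    using rat_padic_abs_frac[OF assms, of "- a" b] rat_padic_abs_frac[OF assms, of a b] ab
    by simp
qed simp

lemma rat_padic_abs_mult:
  assumes "prime p"
  shows "rat_padic_abs p (x * y) = rat_padic_abs p x * rat_padic_abs p y"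
proof (cases "x = 0 \<or> y = 0")
  case False
  then obtain a b c d where
    x: "x = of_int a / of_int b" "a \<noteq> 0" "b \<noteq> 0" and
    y: "y = of_int c / of_int d" "c \<noteq> 0" "d \<noteq> 0"
    by (metis rat_frac_cases)
  have xy: "x * y = of_int (a * c) / of_int (b * d)"
    using x y by simp
  have pe: "prime_elem (int p)" and p0: "real p \<noteq> 0"
    using assms prime_gt_0_nat[OF assms] by simp_all
  have m: "multiplicity (int p) (a * c) = multiplicity (int p) a + multiplicity (int p) c"
    "multiplicity (int p) (b * d) = multiplicity (int p) b + multiplicity (int p) d"
    using x y by (simp_all add: prime_elem_multiplicity_mult_distrib[OF pe])
  have "rat_padic_abs p (x * y)
      = real p powi ((int (multiplicity (int p) b) - int (multiplicity (int p) a))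
                   + (int (multiplicity (int p) d) - int (multiplicity (int p) c)))"
    unfolding xy using rat_padic_abs_frac[OF assms, of "a * c" "b * d"] x y
    by (simp add: m algebra_simps)
  also have "\<dots> = rat_padic_abs p x * rat_padic_abs p y"
    using rat_padic_abs_frac[OF assms] x y p0 by (simp add: power_int_add)
  finally show ?thesis .
qed auto

lemma rat_padic_abs_ultrametric:
  assumes "prime p"
  shows "rat_padic_abs p (x + y) \<le> max (rat_padic_abs p x) (rat_padic_abs p y)"
proof (cases "x = 0 \<or> y = 0 \<or> x + y = 0")
  case True
  then show ?thesis
    by (auto simp: le_max_iff_disj)
next
  case False
  then obtain a b c d where
    x: "x = of_int a / of_int b" "a \<noteq> 0" "b \<noteq> 0" and
    y: "y = of_int c / of_int d" "c \<noteq> 0" "d \<noteq> 0"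
    by (metis rat_frac_cases)
  define m where "m = min (multiplicity (int p) (a * d)) (multiplicity (int p) (c * b))"
  have x': "x = of_int (a * d) / of_int (b * d)" and y': "y = of_int (c * b) / of_int (b * d)"
    using x y by simp_all
  have xy: "x + y = of_int (a * d + c * b) / of_int (b * d)"
    unfolding x' y' by (simp add: add_divide_distrib)
  have s0: "a * d + c * b \<noteq> 0"
  proof
    assume "a * d + c * b = 0"
    then have "x + y = 0"
      unfolding xy by simp
    then show False
      using False by blast
  qed
  have "int p ^ m dvd a * d" "int p ^ m dvd c * b"
    by (simp_all add: m_def multiplicity_dvd')
  then have "int p ^ m dvd a * d + c * b"
    by simp
  then have m: "m \<le> multiplicity (int p) (a * d + c * b)"
    using s0 prime_gt_1_nat[OF assms] by (intro multiplicity_geI) auto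
  have p1: "real p \<ge> 1"
    using prime_gt_1_nat[OF assms] by simp
  have "rat_padic_abs p (x + y) \<le> real p powi (int (multiplicity (int p) (b * d)) - int m)"
    unfolding xy using rat_padic_abs_frac[OF assms s0, of "b * d"] x y m p1
    by (auto intro!: power_int_increasing)
  also have "\<dots> \<le> max (rat_padic_abs p x) (rat_padic_abs p y)"
    unfolding x' y'
    using rat_padic_abs_frac[OF assms, of "a * d" "b * d"]
      rat_padic_abs_frac[OF assms, of "c * b" "b * d"] x y
    by (auto simp: m_def min_def)
  finally show ?thesis .
qed

lemma rat_padic_abs_triangle:
  assumes "prime p"
  shows "rat_padic_abs p (x + y) \<le> rat_padic_abs p x + rat_padic_abs p y"
  using rat_padic_abs_ultrametric[OF assms, of x y]
    rat_padic_abs_nonneg[of p x] rat_padic_abs_nonneg[of p y] by linarith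

lemma rat_padic_abs_diff_commute:
  assumes "prime p"
  shows "rat_padic_abs p (x - y) = rat_padic_abs p (y - x)"
  using rat_padic_abs_minus[OF assms, of "x - y"] by simp

lemma rat_padic_abs_abs_diff:
  assumes "prime p"
  shows "\<bar>rat_padic_abs p x - rat_padic_abs p y\<bar> \<le> rat_padic_abs p (x - y)"
  using rat_padic_abs_triangle[OF assms, of "x - y" y]
    rat_padic_abs_triangle[OF assms, of "y - x" x]
    rat_padic_abs_diff_commute[OF assms, of x y] by simp


subsection \<open>Cauchy sequences and null sequences\<close>

definition padic_Cauchy :: "nat \<Rightarrow> (nat \<Rightarrow> rat) \<Rightarrow> bool" where
  "padic_Cauchy p X \<longleftrightarrow> (\<forall>e>0. \<exists>k. \<forall>m\<ge>k. \<forall>n\<ge>k. rat_padic_abs p (X m - X n) < e)"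

definition padic_null :: "nat \<Rightarrow> (nat \<Rightarrow> rat) \<Rightarrow> bool" where
  "padic_null p X \<longleftrightarrow> (\<lambda>n. rat_padic_abs p (X n)) \<longlonglongrightarrow> 0"

lemma padic_null_bound:
  assumes "\<And>n. rat_padic_abs p (X n) \<le> g n" "g \<longlonglongrightarrow> 0"
  shows "padic_null p X"
  unfolding padic_null_def
  by (rule tendsto_sandwich[of "\<lambda>_. 0" _ _ g]) (use assms in auto)

lemma padic_null_0 [simp]: "padic_null p (\<lambda>n. 0)"
  by (simp add: padic_null_def)

lemma padic_null_add:
  assumes "prime p" "padic_null p X" "padic_null p Y"
  shows "padic_null p (\<lambda>n. X n + Y n)"
proof (rule padic_null_bound)
  show "rat_padic_abs p (X n + Y n) \<le> rat_padic_abs p (X n) + rat_padic_abs p (Y n)" for n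
    by (rule rat_padic_abs_triangle[OF assms(1)])
  show "(\<lambda>n. rat_padic_abs p (X n) + rat_padic_abs p (Y n)) \<longlonglongrightarrow> 0"
    using tendsto_add[of "\<lambda>n. rat_padic_abs p (X n)" 0 _ "\<lambda>n. rat_padic_abs p (Y n)" 0] assms
    by (simp add: padic_null_def)
qed

lemma padic_null_minus:
  assumes "prime p" "padic_null p X"
  shows "padic_null p (\<lambda>n. - X n)"
  using assms by (simp add: padic_null_def)

lemma padic_Cauchy_const [simp]: "padic_Cauchy p (\<lambda>n. c)"
  by (simp add: padic_Cauchy_def)

lemma padic_Cauchy_convergent:
  assumes p: "prime p" and X: "padic_Cauchy p X"
  shows "convergent (\<lambda>n. rat_padic_abs p (X n))"
proof -
  have "Cauchy (\<lambda>n. rat_padic_abs p (X n))"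
    unfolding Cauchy_def dist_real_def
    using X rat_padic_abs_abs_diff[OF p] unfolding padic_Cauchy_def
    by (meson le_less_trans)
  then show ?thesis
    by (simp add: Cauchy_convergent_iff)
qed

lemma padic_Cauchy_bounded:
  assumes p: "prime p" and X: "padic_Cauchy p X"
  obtains B where "B > 0" "\<And>n. rat_padic_abs p (X n) \<le> B"
proof -
  have "Bseq (\<lambda>n. rat_padic_abs p (X n))"
    using padic_Cauchy_convergent[OF assms] by (rule convergent_imp_Bseq)
  then obtain B where "B > 0" "\<And>n. norm (rat_padic_abs p (X n)) \<le> B"
    by (auto elim: BseqE)
  then show ?thesis
    using that by auto
qed

lemma padic_Cauchy_add:
  assumes p: "prime p" and X: "padic_Cauchy p X" and Y: "padic_Cauchy p Y"
  shows "padic_Cauchy p (\<lambda>n. X n + Y n)"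
  unfolding padic_Cauchy_def
proof (intro allI impI)
  fix e :: real
  assume e: "e > 0"
  obtain j where j: "\<forall>m\<ge>j. \<forall>n\<ge>j. rat_padic_abs p (X m - X n) < e"
    using X e unfolding padic_Cauchy_def by blast
  obtain k where k: "\<forall>m\<ge>k. \<forall>n\<ge>k. rat_padic_abs p (Y m - Y n) < e"
    using Y e unfolding padic_Cauchy_def by blast
  have "rat_padic_abs p ((X m + Y m) - (X n + Y n)) < e" if "m \<ge> max j k" "n \<ge> max j k" for m n
  proof -
    have "rat_padic_abs p ((X m + Y m) - (X n + Y n))
        \<le> max (rat_padic_abs p (X m - X n)) (rat_padic_abs p (Y m - Y n))"
      using rat_padic_abs_ultrametric[OF p, of "X m - X n" "Y m - Y n"]
      by (simp add: algebra_simps)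
    also have "\<dots> < e"
      using j k that by simp
    finally show ?thesis .
  qed
  then show "\<exists>k. \<forall>m\<ge>k. \<forall>n\<ge>k. rat_padic_abs p ((X m + Y m) - (X n + Y n)) < e"
    by blast
qed

lemma padic_Cauchy_minus:
  assumes p: "prime p" and X: "padic_Cauchy p X"
  shows "padic_Cauchy p (\<lambda>n. - X n)"
proof -
  have "rat_padic_abs p (- X m - - X n) = rat_padic_abs p (X m - X n)" for m n
    using rat_padic_abs_minus[OF p, of "X m - X n"] by simp
  then show ?thesis
    using X by (simp add: padic_Cauchy_def)
qed

lemma padic_Cauchy_mult:
  assumes p: "prime p" and X: "padic_Cauchy p X" and Y: "padic_Cauchy p Y"
  shows "padic_Cauchy p (\<lambda>n. X n * Y n)"
  unfolding padic_Cauchy_def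
proof (intro allI impI)
  fix e :: real
  assume e: "e > 0"
  obtain A where A: "A > 0" "\<And>n. rat_padic_abs p (X n) \<le> A"
    using padic_Cauchy_bounded[OF p X] by blast
  obtain B where B: "B > 0" "\<And>n. rat_padic_abs p (Y n) \<le> B"
    using padic_Cauchy_bounded[OF p Y] by blast
  obtain j where j: "\<forall>m\<ge>j. \<forall>n\<ge>j. rat_padic_abs p (X m - X n) < e / B"
    using X e B unfolding padic_Cauchy_def by (meson divide_pos_pos)
  obtain k where k: "\<forall>m\<ge>k. \<forall>n\<ge>k. rat_padic_abs p (Y m - Y n) < e / A"
    using Y e A unfolding padic_Cauchy_def by (meson divide_pos_pos)
  have "rat_padic_abs p (X m * Y m - X n * Y n) < e" if mn: "m \<ge> max j k" "n \<ge> max j k" for m n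
  proof -
    have "X m * Y m - X n * Y n = X m * (Y m - Y n) + (X m - X n) * Y n"
      by (simp add: algebra_simps)
    then have "rat_padic_abs p (X m * Y m - X n * Y n)
        \<le> max (rat_padic_abs p (X m) * rat_padic_abs p (Y m - Y n))
              (rat_padic_abs p (X m - X n) * rat_padic_abs p (Y n))"
      using rat_padic_abs_ultrametric[OF p, of "X m * (Y m - Y n)" "(X m - X n) * Y n"]
      by (simp add: rat_padic_abs_mult[OF p])
    also have "\<dots> \<le> max (A * rat_padic_abs p (Y m - Y n)) (rat_padic_abs p (X m - X n) * B)"
      using A B by (intro max.mono mult_right_mono mult_left_mono) auto
    also have "\<dots> < e"
      using j k mn A(1) B(1) by (simp add: field_simps)
    finally show ?thesis .
  qed
  then show "\<exists>k. \<forall>m\<ge>k. \<forall>n\<ge>k. rat_padic_abs p (X m * Y m - X n * Y n) < e"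
    by blast
qed

lemma padic_null_mult:
  assumes p: "prime p" and X: "padic_null p X" and Y: "padic_Cauchy p Y"
  shows "padic_null p (\<lambda>n. X n * Y n)"
proof -
  obtain B where B: "B > 0" "\<And>n. rat_padic_abs p (Y n) \<le> B"
    using padic_Cauchy_bounded[OF p Y] by blast
  show ?thesis
  proof (rule padic_null_bound)
    show "rat_padic_abs p (X n * Y n) \<le> rat_padic_abs p (X n) * B" for n
      using B by (simp add: rat_padic_abs_mult[OF p] mult_left_mono)
    show "(\<lambda>n. rat_padic_abs p (X n) * B) \<longlonglongrightarrow> 0"
      using X unfolding padic_null_def by (rule tendsto_mult_left_zero)
  qed
qed

lemma padic_Cauchy_not_null:
  assumes p: "prime p" and X: "padic_Cauchy p X" "\<not> padic_null p X"
  obtains b k where "b > 0" "\<And>n. n \<ge> k \<Longrightarrow> rat_padic_abs p (X n) \<ge> b"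
proof -
  define L where "L = lim (\<lambda>n. rat_padic_abs p (X n))"
  have L: "(\<lambda>n. rat_padic_abs p (X n)) \<longlonglongrightarrow> L"
    using padic_Cauchy_convergent[OF p X(1)] by (simp add: L_def convergent_LIMSEQ_iff)
  have "L \<ge> 0"
    by (rule LIMSEQ_le_const[OF L]) auto
  moreover have "L \<noteq> 0"
    using L X(2) by (auto simp: padic_null_def)
  ultimately have "L > 0"
    by simp
  then have "eventually (\<lambda>n. rat_padic_abs p (X n) > L / 2) sequentially"
    using order_tendstoD(1)[OF L, of "L / 2"] by simp
  then obtain k where "\<And>n. n \<ge> k \<Longrightarrow> rat_padic_abs p (X n) > L / 2"
    by (auto simp: eventually_sequentially)
  with \<open>L > 0\<close> show ?thesis
    by (intro that[of "L / 2" k]) (auto intro: less_imp_le)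
qed

lemma rat_padic_abs_inverse:
  assumes p: "prime p"
  shows "rat_padic_abs p (inverse x) = inverse (rat_padic_abs p x)"
proof (cases "x = 0")
  case False
  then have "rat_padic_abs p x * rat_padic_abs p (inverse x) = 1"
    using rat_padic_abs_mult[OF p, of x "inverse x"] by simp
  then show ?thesis
    by (metis inverse_unique)
qed simp

lemma rat_padic_abs_inverse_diff:
  assumes p: "prime p" and b: "b > 0" "rat_padic_abs p x \<ge> b" "rat_padic_abs p y \<ge> b"
  shows "rat_padic_abs p (inverse x - inverse y) \<le> rat_padic_abs p (x - y) / b\<^sup>2"
proof -
  have "x \<noteq> 0" "y \<noteq> 0"
    using b by auto
  then have "inverse x - inverse y = (y - x) * (inverse x * inverse y)"
    by (simp add: field_simps)
  then have "rat_padic_abs p (inverse x - inverse y)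
      = rat_padic_abs p (x - y) * (inverse (rat_padic_abs p x) * inverse (rat_padic_abs p y))"
    using rat_padic_abs_diff_commute[OF p, of x y]
    by (simp add: rat_padic_abs_mult[OF p] rat_padic_abs_inverse[OF p])
  also have "\<dots> \<le> rat_padic_abs p (x - y) * (inverse b * inverse b)"
    using b by (intro mult_left_mono mult_mono le_imp_inverse_le) auto
  finally show ?thesis
    by (simp add: power2_eq_square field_simps)
qed

lemma padic_Cauchy_inverse:
  assumes p: "prime p" and X: "padic_Cauchy p X" "\<not> padic_null p X"
  shows "padic_Cauchy p (\<lambda>n. inverse (X n))"
  unfolding padic_Cauchy_def
proof (intro allI impI)
  fix e :: real
  assume e: "e > 0"
  obtain b k where b: "b > 0" "\<And>n. n \<ge> k \<Longrightarrow> rat_padic_abs p (X n) \<ge> b"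
    using padic_Cauchy_not_null[OF p X] by blast
  have "e * b\<^sup>2 > 0"
    using e b by simp
  then obtain j where j: "\<forall>m\<ge>j. \<forall>n\<ge>j. rat_padic_abs p (X m - X n) < e * b\<^sup>2"
    using X(1) unfolding padic_Cauchy_def by blast
  have "rat_padic_abs p (inverse (X m) - inverse (X n)) < e"
    if mn: "m \<ge> max j k" "n \<ge> max j k" for m n
  proof -
    have "rat_padic_abs p (inverse (X m) - inverse (X n)) \<le> rat_padic_abs p (X m - X n) / b\<^sup>2"
      using b mn by (intro rat_padic_abs_inverse_diff[OF p]) auto
    also have "\<dots> < e"
      using j mn b(1) by (simp add: field_simps)
    finally show ?thesis .
  qed
  then show "\<exists>k. \<forall>m\<ge>k. \<forall>n\<ge>k. rat_padic_abs p (inverse (X m) - inverse (X n)) < e"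
    by blast
qed

lemma padic_null_inverse_diff:
  assumes p: "prime p" and X: "padic_Cauchy p X" "\<not> padic_null p X"
    and Y: "padic_Cauchy p Y" "\<not> padic_null p Y"
    and XY: "padic_null p (\<lambda>n. X n - Y n)"
  shows "padic_null p (\<lambda>n. inverse (X n) - inverse (Y n))"
proof -
  obtain b j where b: "b > 0" "\<And>n. n \<ge> j \<Longrightarrow> rat_padic_abs p (X n) \<ge> b"
    using padic_Cauchy_not_null[OF p X] by blast
  obtain c k where c: "c > 0" "\<And>n. n \<ge> k \<Longrightarrow> rat_padic_abs p (Y n) \<ge> c"
    using padic_Cauchy_not_null[OF p Y] by blast
  define d where "d = min b c"
  have ev: "eventually (\<lambda>n. rat_padic_abs p (inverse (X n) - inverse (Y n))
      \<le> rat_padic_abs p (X n - Y n) / d\<^sup>2) sequentially"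
    using eventually_ge_at_top[of "max j k"]
  proof eventually_elim
    case (elim n)
    then have "b \<le> rat_padic_abs p (X n)" "c \<le> rat_padic_abs p (Y n)"
      using b c by auto
    then show ?case
      using b(1) c(1) by (intro rat_padic_abs_inverse_diff[OF p]) (auto simp: d_def)
  qed
  have lim: "(\<lambda>n. rat_padic_abs p (X n - Y n) / d\<^sup>2) \<longlonglongrightarrow> 0"
    using XY unfolding padic_null_def by (rule tendsto_divide_zero)
  show ?thesis
    unfolding padic_null_def
    by (rule tendsto_sandwich[OF _ ev tendsto_const lim]) simp
qed


subsection \<open>The field of $p$-adic numbers\<close>

text \<open>
  The completion of the rationals with respect to the $p$-adic absolute value: Cauchy sequences
  modulo null sequences. The prime is the cardinality of the type argument; every prime occurs,
  since for each \<open>n > 0\<close> there is a type with \<open>n\<close> elements.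
\<close>

typedef (overloaded) 'p padic_seq = "{X. padic_Cauchy CARD('p::prime_card) X}"
  by (rule exI[of _ "\<lambda>n. 0"]) simp

setup_lifting type_definition_padic_seq

lift_definition padic_equiv :: "'p::prime_card padic_seq \<Rightarrow> 'p padic_seq \<Rightarrow> bool"
  is "\<lambda>X Y. padic_null CARD('p) (\<lambda>n. X n - Y n)" .

lemma equivp_padic_equiv: "equivp (padic_equiv :: 'p::prime_card padic_seq \<Rightarrow> _)"
proof (rule equivpI)
  show "reflp (padic_equiv :: 'p padic_seq \<Rightarrow> _)"
    by (rule reflpI, transfer) simp
  show "symp (padic_equiv :: 'p padic_seq \<Rightarrow> _)"
    by (rule sympI, transfer)
       (simp add: padic_null_def rat_padic_abs_diff_commute[OF prime_card])
  show "transp (padic_equiv :: 'p padic_seq \<Rightarrow> _)"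
  proof (rule transpI, transfer)
    fix X Y Z :: "nat \<Rightarrow> rat"
    assume "padic_null CARD('p) (\<lambda>n. X n - Y n)" "padic_null CARD('p) (\<lambda>n. Y n - Z n)"
    from padic_null_add[OF prime_card this] show "padic_null CARD('p) (\<lambda>n. X n - Z n)"
      by simp
  qed
qed

lift_definition const_seq :: "rat \<Rightarrow> 'p::prime_card padic_seq" is "\<lambda>c n. c"
  by simp

lift_definition add_seq :: "'p::prime_card padic_seq \<Rightarrow> 'p padic_seq \<Rightarrow> 'p padic_seq"
  is "\<lambda>X Y n. X n + Y n"
  by (rule padic_Cauchy_add[OF prime_card])

lift_definition minus_seq :: "'p::prime_card padic_seq \<Rightarrow> 'p padic_seq" is "\<lambda>X n. - X n"
  by (rule padic_Cauchy_minus[OF prime_card])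

lift_definition mult_seq :: "'p::prime_card padic_seq \<Rightarrow> 'p padic_seq \<Rightarrow> 'p padic_seq"
  is "\<lambda>X Y n. X n * Y n"
  by (rule padic_Cauchy_mult[OF prime_card])

lift_definition inverse_seq :: "'p::prime_card padic_seq \<Rightarrow> 'p padic_seq"
  is "\<lambda>X. if padic_null CARD('p) X then (\<lambda>n. 0) else (\<lambda>n. inverse (X n))"
  by (simp add: padic_Cauchy_inverse[OF prime_card])

lift_definition abs_seq :: "'p::prime_card padic_seq \<Rightarrow> real"
  is "\<lambda>X. lim (\<lambda>n. rat_padic_abs CARD('p) (X n))" .

lemma add_seq_cong:
  "padic_equiv X X' \<Longrightarrow> padic_equiv Y Y' \<Longrightarrow> padic_equiv (add_seq X Y) (add_seq X' Y')"
  for X X' Y Y' :: "'p::prime_card padic_seq"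
proof (transfer, goal_cases)
  case (1 X X' Y Y')
  have "padic_null CARD('p) (\<lambda>n. (X n - X' n) + (Y n - Y' n))"
    using 1 by (intro padic_null_add prime_card)
  then show ?case
    by (simp add: algebra_simps)
qed

lemma minus_seq_cong: "padic_equiv X X' \<Longrightarrow> padic_equiv (minus_seq X) (minus_seq X')"
  for X X' :: "'p::prime_card padic_seq"
proof (transfer, goal_cases)
  case (1 X X')
  from padic_null_minus[OF prime_card 1(3)] show ?case
    by (simp add: algebra_simps)
qed

lemma mult_seq_cong:
  "padic_equiv X X' \<Longrightarrow> padic_equiv Y Y' \<Longrightarrow> padic_equiv (mult_seq X Y) (mult_seq X' Y')"
  for X X' Y Y' :: "'p::prime_card padic_seq"
proof (transfer, goal_cases)
  case (1 X X' Y Y')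
  have "padic_null CARD('p) (\<lambda>n. (X n - X' n) * Y n + (Y n - Y' n) * X' n)"
    using 1 by (intro padic_null_add padic_null_mult prime_card)
  then show ?case
    by (simp add: algebra_simps)
qed

lemma inverse_seq_cong: "padic_equiv X X' \<Longrightarrow> padic_equiv (inverse_seq X) (inverse_seq X')"
  for X X' :: "'p::prime_card padic_seq"
proof (transfer, goal_cases)
  case (1 X X')
  have "padic_null CARD('p) (\<lambda>n. X' n - X n)"
    using padic_null_minus[OF prime_card 1(3)] by simp
  then have "padic_null CARD('p) X \<longleftrightarrow> padic_null CARD('p) X'"
    using padic_null_add[OF prime_card, where ?'a1 = 'p, of X "\<lambda>n. X' n - X n"]
      padic_null_add[OF prime_card, where ?'a1 = 'p, of X' "\<lambda>n. X n - X' n"] 1(3) by auto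
  then show ?case
    using 1 by (auto intro: padic_null_inverse_diff[OF prime_card])
qed

lemma abs_seq_cong: "padic_equiv X X' \<Longrightarrow> abs_seq X = abs_seq X'"
  for X X' :: "'p::prime_card padic_seq"
proof (transfer, goal_cases)
  case (1 X X')
  let ?a = "rat_padic_abs CARD('p)"
  have "(\<lambda>n. ?a (X n)) \<longlonglongrightarrow> lim (\<lambda>n. ?a (X n))"
    using padic_Cauchy_convergent[OF prime_card 1(1)] by (simp add: convergent_LIMSEQ_iff)
  moreover have "(\<lambda>n. ?a (X' n) - ?a (X n)) \<longlonglongrightarrow> 0"
  proof (rule Lim_null_comparison)
    show "eventually (\<lambda>n. norm (?a (X' n) - ?a (X n)) \<le> ?a (X n - X' n)) sequentially"
      using rat_padic_abs_abs_diff[OF prime_card, where ?'a1 = 'p]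
        rat_padic_abs_diff_commute[OF prime_card, where ?'a1 = 'p]
      by (intro always_eventually) (metis real_norm_def)
    show "(\<lambda>n. ?a (X n - X' n)) \<longlonglongrightarrow> 0"
      using 1(3) by (simp add: padic_null_def)
  qed
  ultimately have "(\<lambda>n. ?a (X n) + (?a (X' n) - ?a (X n))) \<longlonglongrightarrow> lim (\<lambda>n. ?a (X n)) + 0"
    by (rule tendsto_add)
  then show ?case
    by (simp add: limI)
qed

quotient_type (overloaded) 'p padic = "'p::prime_card padic_seq" / padic_equiv
  morphisms seq_of_padic padic_of_seq
  by (rule equivp_padic_equiv)

instantiation padic :: (prime_card) field
begin

lift_definition zero_padic :: "'a padic" is "const_seq 0" .

lift_definition one_padic :: "'a padic" is "const_seq 1" .

lift_definition plus_padic :: "'a padic \<Rightarrow> 'a padic \<Rightarrow> 'a padic" is add_seq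
  by (rule add_seq_cong)

lift_definition uminus_padic :: "'a padic \<Rightarrow> 'a padic" is minus_seq
  by (rule minus_seq_cong)

lift_definition times_padic :: "'a padic \<Rightarrow> 'a padic \<Rightarrow> 'a padic" is mult_seq
  by (rule mult_seq_cong)

lift_definition inverse_padic :: "'a padic \<Rightarrow> 'a padic" is inverse_seq
  by (rule inverse_seq_cong)

definition "x - y = x + - y" for x y :: "'a padic"

definition "x div y = x * inverse y" for x y :: "'a padic"

instance
proof
  fix a b c :: "'a padic"
  show "a + b = b + a"
    by (transfer, transfer) (simp add: ac_simps)
  show "(a + b) + c = a + (b + c)"
    by (transfer, transfer) (simp add: ac_simps)
  show "0 + a = a"
    by (transfer, transfer) simp
  show "- a + a = 0"
    by (transfer, transfer) simp
  show "a - b = a + - b"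
    by (rule minus_padic_def)
  show "(a * b) * c = a * (b * c)"
    by (transfer, transfer) (simp add: ac_simps)
  show "a * b = b * a"
    by (transfer, transfer) (simp add: ac_simps)
  show "1 * a = a"
    by (transfer, transfer) simp
  show "(a + b) * c = a * c + b * c"
    by (transfer, transfer) (simp add: algebra_simps)
  show "(0::'a padic) \<noteq> 1"
    by (transfer, transfer) (simp add: padic_null_def prime_card LIMSEQ_const_iff)
  show "a \<noteq> 0 \<Longrightarrow> inverse a * a = 1"
  proof (transfer, transfer, goal_cases)
    case (1 X)
    then have nn: "\<not> padic_null CARD('a) X"
      by simp
    then obtain b k where b: "b > 0" "\<And>n. n \<ge> k \<Longrightarrow> rat_padic_abs CARD('a) (X n) \<ge> b"
      using padic_Cauchy_not_null[OF prime_card 1(1)] by blast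
    have "eventually (\<lambda>n. rat_padic_abs CARD('a) (inverse (X n) * X n - 1) = 0) sequentially"
      using eventually_ge_at_top[of k]
    proof eventually_elim
      case (elim n)
      then have "X n \<noteq> 0"
        using b by force
      then show ?case
        by simp
    qed
    then show ?case
      using nn by (simp add: padic_null_def tendsto_eventually)
  qed
  show "a div b = a * inverse b"
    by (rule divide_padic_def)
  show "inverse (0::'a padic) = 0"
    by (transfer, transfer) simp
qed

end

lift_definition padic_abs :: "'p::prime_card padic \<Rightarrow> real" is abs_seq
  by (rule abs_seq_cong)

lemma tendsto_lim_rat_padic_abs:
  "padic_Cauchy CARD('p::prime_card) X \<Longrightarrow>
     (\<lambda>n. rat_padic_abs CARD('p) (X n)) \<longlonglongrightarrow> lim (\<lambda>n. rat_padic_abs CARD('p) (X n))"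
  using padic_Cauchy_convergent[OF prime_card] by (simp add: convergent_LIMSEQ_iff)

lemma padic_abs_eq_0_iff: "padic_abs x = 0 \<longleftrightarrow> x = 0" for x :: "'p::prime_card padic"
proof (transfer, transfer, goal_cases)
  case (1 X)
  have "lim (\<lambda>n. rat_padic_abs CARD('p) (X n)) = 0 \<longleftrightarrow> padic_null CARD('p) X"
    using tendsto_lim_rat_padic_abs[OF 1] limI unfolding padic_null_def by metis
  then show ?case
    by simp
qed

lemma padic_abs_minus: "padic_abs (- x) = padic_abs x" for x :: "'p::prime_card padic"
  by (transfer, transfer) (simp add: rat_padic_abs_minus[OF prime_card])

lemma padic_abs_mult: "padic_abs (x * y) = padic_abs x * padic_abs y"
  for x y :: "'p::prime_card padic"
proof (transfer, transfer, goal_cases)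
  case (1 X Y)
  then show ?case
    using tendsto_mult[OF tendsto_lim_rat_padic_abs[OF 1(1)] tendsto_lim_rat_padic_abs[OF 1(2)]]
    by (intro limI) (simp add: rat_padic_abs_mult[OF prime_card])
qed

lemma padic_abs_ultrametric: "padic_abs (x + y) \<le> max (padic_abs x) (padic_abs y)"
  for x y :: "'p::prime_card padic"
proof (transfer, transfer, goal_cases)
  case (1 X Y)
  note lims = tendsto_lim_rat_padic_abs[OF 1(1)] tendsto_lim_rat_padic_abs[OF 1(2)]
    tendsto_lim_rat_padic_abs[OF padic_Cauchy_add[OF prime_card 1]]
  show ?case
    by (rule LIMSEQ_le[OF lims(3) tendsto_max[OF lims(1,2)]])
       (use rat_padic_abs_ultrametric[OF prime_card] in blast)
qed

lemma padic_abs_nonneg: "padic_abs x \<ge> 0" for x :: "'p::prime_card padic"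
proof (transfer, transfer, goal_cases)
  case (1 X)
  show ?case
    by (rule LIMSEQ_le_const[OF tendsto_lim_rat_padic_abs[OF 1]]) auto
qed

lemma padic_abs_of_const_seq:
  "padic_abs (padic_of_seq (const_seq c) :: 'p::prime_card padic) = rat_padic_abs CARD('p) c"
  unfolding padic_abs.abs_eq by transfer (simp add: limI)

instantiation padic :: (prime_card) metric_space
begin

definition dist_padic :: "'a padic \<Rightarrow> 'a padic \<Rightarrow> real"
  where "dist_padic x y = padic_abs (x - y)"

definition uniformity_padic :: "('a padic \<times> 'a padic) filter"
  where "uniformity_padic = (INF e\<in>{0<..}. principal {(x, y). dist x y < e})"

definition open_padic :: "'a padic set \<Rightarrow> bool"
  where "open_padic U \<longleftrightarrow> (\<forall>x\<in>U. eventually (\<lambda>(x', y). x' = x \<longrightarrow> y \<in> U) uniformity)"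

instance
proof
  fix x y z :: "'a padic"
  show "dist x y = 0 \<longleftrightarrow> x = y"
    by (simp add: dist_padic_def padic_abs_eq_0_iff)
  show "dist x y \<le> dist x z + dist y z"
    using padic_abs_ultrametric[of "x - z" "z - y"] padic_abs_minus[of "y - z"]
      padic_abs_nonneg[of "x - z"] padic_abs_nonneg[of "y - z"]
    by (simp add: dist_padic_def)
qed (rule uniformity_padic_def open_padic_def)+

end


subsection \<open>Haar measure and fractional integration\<close>

definition padic_haar :: "'p::prime_card padic measure \<Rightarrow> bool" where
  "padic_haar M \<longleftrightarrow>
     sets M = sets borel \<and>
     (\<forall>a. \<forall>A\<in>sets M. emeasure M ((+) a ` A) = emeasure M A) \<and>
     emeasure M {y. padic_abs y \<le> 1} = 1"

definition padic_locally_integrable ::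
    "'p::prime_card padic measure \<Rightarrow> ('p padic \<Rightarrow> real) \<Rightarrow> bool" where
  "padic_locally_integrable M f \<longleftrightarrow> (\<forall>K. compact K \<longrightarrow> set_integrable M K f)"

definition padic_frac_const :: "nat \<Rightarrow> real \<Rightarrow> real" where
  "padic_frac_const p \<alpha> = (1 - real p powr (- \<alpha>)) / (1 - real p powr (\<alpha> - 1))"

definition padic_frac_integral ::
    "'p::prime_card padic measure \<Rightarrow> real \<Rightarrow> ('p padic \<Rightarrow> real) \<Rightarrow> 'p padic \<Rightarrow> real" where
  "padic_frac_integral M \<alpha> f x =
     padic_frac_const CARD('p) \<alpha> *
     (LINT y:{y. padic_abs y \<le> padic_abs x}|M.
        (padic_abs (x - y) powr (\<alpha> - 1) - padic_abs y powr (\<alpha> - 1)) * f y)"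

text \<open>
  Totality conventions (division by zero, \<^term>\<open>ln 0\<close>) only affect the integrand at the
  single point \<^term>\<open>t = 0\<close>, which is a null set.
\<close>

definition padic_Omega :: "'p::prime_card padic measure \<Rightarrow> nat \<Rightarrow> real \<Rightarrow> real" where
  "padic_Omega M k \<alpha> =
     (LINT t:{t. padic_abs t \<le> 1}|M.
        (padic_abs (1 - t) powr (\<alpha> - 1) - padic_abs t powr (\<alpha> - 1) - 1)
        / padic_abs t * ln (padic_abs t) ^ k)"

definition padic_B ::
    "'p::prime_card padic measure \<Rightarrow> (nat \<Rightarrow> real) \<Rightarrow> real \<Rightarrow> real \<Rightarrow> nat \<Rightarrow> real" where
  "padic_B M a \<gamma> \<alpha> n =
     (\<Sum>k\<le>n. a (n - k) * ((\<gamma> + real k - real n) gchoose k) * padic_Omega M k \<alpha>)"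

definition padic_at_infinity :: "'p::prime_card padic filter" where
  "padic_at_infinity = filtercomap padic_abs at_top"

end

theory Submission
  imports Defs "HOL-Real_Asymp.Real_Asymp"
begin

text \<open>
  Put \<open>b = \<alpha> - 1\<close> and \<open>K x y = |x - y|\<^sup>b - |y|\<^sup>b - |x|\<^sup>b\<close>. Up to the constant factor, the fractional
  integral is \<open>|x|\<^sup>b\<close> times the integral of \<open>f\<close> over the ball \<open>|y| \<le> |x|\<close>, plus the integral of
  \<open>K x y * f y\<close> over that ball. There \<open>K x y\<close> is at most \<open>2 |y|\<^sup>b\<close> in absolute value, so bounded
  \<open>y\<close> contribute little and \<open>f\<close> may be replaced by its asymptotic expansion, cut off to \<open>|y| > 1\<close>.
  For radial functions the integral is a series over the spheres on which \<open>|y|\<close> is a fixed power of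
  \<open>p\<close>: if \<open>|x| = p\<^sup>m\<close>, the term \<open>(log |y|)\<^sup>s / |y|\<close> leads to the sum of \<open>q\<^sup>i (m - i)\<^sup>s\<close> over \<open>i < m\<close>,
  where \<open>q\<close> is the inverse of \<open>p\<^sup>b\<close>. Expanding \<open>(1 - i / m)\<^sup>s\<close> by the binomial series, which
  Tannery's theorem permits, gives the moments of \<open>q\<^sup>i\<close>, and these are what the constants
  \<open>\<Omega>(k, \<alpha>)\<close> reduce to.
\<close>

subsection \<open>Balls in the field of p-adic numbers\<close>

lift_definition padic_of_rat :: "rat \<Rightarrow> 'p::prime_card padic" is const_seq .

lemma padic_abs_of_rat: "padic_abs (padic_of_rat c :: 'p::prime_card padic) = rat_padic_abs CARD('p) c"
  unfolding padic_of_rat.abs_eq by (rule padic_abs_of_const_seq)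

lemma padic_of_rat_1: "padic_of_rat 1 = 1"
  by transfer (rule equivp_reflp[OF equivp_padic_equiv])

lemma padic_of_rat_0: "padic_of_rat 0 = 0"
  by transfer (rule equivp_reflp[OF equivp_padic_equiv])

lemma padic_of_rat_add: "padic_of_rat (a + b) = padic_of_rat a + padic_of_rat b"
  by (transfer, transfer) simp

lemma padic_of_rat_minus: "padic_of_rat (- a) = - padic_of_rat a"
  by (transfer, transfer) simp

lemma padic_of_rat_diff: "padic_of_rat (a - b) = padic_of_rat a - padic_of_rat b"
  using padic_of_rat_add[of a "- b"] by (simp add: padic_of_rat_minus)

lemma padic_of_rat_of_nat: "padic_of_rat (of_nat n) = of_nat n"
  by (induction n) (simp_all add: padic_of_rat_0 padic_of_rat_1 padic_of_rat_add)

lemma padic_abs_0 [simp]: "padic_abs (0 :: 'p::prime_card padic) = 0"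
  by (simp add: padic_abs_eq_0_iff)

lemma padic_abs_1 [simp]: "padic_abs (1 :: 'p::prime_card padic) = 1"
  using padic_abs_of_rat[where 'p='p, of 1] by (simp add: padic_of_rat_1)

lemma padic_abs_pos: "x \<noteq> 0 \<Longrightarrow> padic_abs x > 0" for x :: "'p::prime_card padic"
  using padic_abs_nonneg[of x] padic_abs_eq_0_iff[of x] by simp

lemma padic_abs_diff_commute: "padic_abs (x - y) = padic_abs (y - x)" for x :: "'p::prime_card padic"
  using padic_abs_minus[of "x - y"] by simp

lemma padic_abs_diff_le: "padic_abs (x - y) \<le> max (padic_abs x) (padic_abs y)"
  for x :: "'p::prime_card padic"
  using padic_abs_ultrametric[of x "- y"] by (simp add: padic_abs_minus)

lemma padic_abs_isosceles:
  fixes x y :: "'p::prime_card padic"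
  assumes "padic_abs y < padic_abs x"
  shows "padic_abs (x - y) = padic_abs x"
  using padic_abs_diff_le[of x y] padic_abs_ultrametric[of "x - y" y] assms
  by (simp add: max_def split: if_splits)

lemma padic_abs_inverse: "padic_abs (inverse x) = inverse (padic_abs x)" for x :: "'p::prime_card padic"
proof (cases "x = 0")
  case False
  then have "padic_abs x * padic_abs (inverse x) = 1"
    by (simp flip: padic_abs_mult)
  then show ?thesis
    by (metis inverse_unique)
qed simp

lemma padic_abs_power: "padic_abs (x ^ n) = padic_abs x ^ n" for x :: "'p::prime_card padic"
  by (induction n) (simp_all add: padic_abs_mult)

lemma padic_abs_power_int: "padic_abs (x powi k) = padic_abs x powi k" for x :: "'p::prime_card padic"
  by (simp add: power_int_def padic_abs_power padic_abs_inverse)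

lemma prime_card_gt_1: "real CARD('p::prime_card) > 1"
  using prime_gt_1_nat[OF prime_card[where 'a='p]] by simp

lemma rat_padic_abs_of_int_coprime:
  assumes "prime p" "\<not> int p dvd k"
  shows "rat_padic_abs p (of_int k) = 1"
proof -
  have "k \<noteq> 0" using assms by auto
  with rat_padic_abs_frac[OF assms(1) this, of 1] show ?thesis
    using assms by (simp add: not_dvd_imp_multiplicity_0)
qed

lemma padic_abs_of_card: "padic_abs (of_nat CARD('p) :: 'p::prime_card padic) = inverse (real CARD('p))"
proof -
  let ?p = "CARD('p)"
  have pr: "prime ?p" by (rule prime_card)
  have "rat_padic_abs ?p (of_nat ?p) = real ?p powi (- 1)"
    using rat_padic_abs_frac[OF pr, of "int ?p" 1] pr
    by (simp add: multiplicity_self prime_gt_0_nat)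
  then show ?thesis
    by (simp add: padic_of_rat_of_nat[symmetric] padic_abs_of_rat)
qed

section \<open>Density of the rationals and completeness\<close>

lemma padic_of_seq_approx:
  fixes X :: "'p::prime_card padic_seq"
  assumes "e > 0"
  shows "\<exists>k. \<forall>n\<ge>k. padic_abs (padic_of_seq X - padic_of_rat (Rep_padic_seq X n)) \<le> e"
proof -
  have X: "padic_Cauchy CARD('p) (Rep_padic_seq X)"
    using Rep_padic_seq[of X] by simp
  then obtain k where k: "\<And>m n. m \<ge> k \<Longrightarrow> n \<ge> k \<Longrightarrow>
      rat_padic_abs CARD('p) (Rep_padic_seq X m - Rep_padic_seq X n) < e"
    using assms unfolding padic_Cauchy_def by metis
  have "padic_abs (padic_of_seq X - padic_of_rat (Rep_padic_seq X n)) \<le> e" if "n \<ge> k" for n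
  proof -
    let ?Y = "\<lambda>i. Rep_padic_seq X i + - Rep_padic_seq X n"
    have "padic_abs (padic_of_seq X - padic_of_rat (Rep_padic_seq X n))
        = abs_seq (add_seq X (minus_seq (const_seq (Rep_padic_seq X n))))"
      by (simp only: minus_padic_def padic_of_rat.abs_eq uminus_padic.abs_eq plus_padic.abs_eq padic_abs.abs_eq)
    \<comment> \<open>The distance from the class of \<open>X\<close> to its \<open>n\<close>-th
      term is a limit of rational distances, which the Cauchy condition keeps below
      \<open>e\<close>; passing to the limit costs the strict inequality.\<close>
    also have "\<dots> = lim (\<lambda>i. rat_padic_abs CARD('p) (?Y i))"
      by (simp add: abs_seq.rep_eq add_seq.rep_eq minus_seq.rep_eq const_seq.rep_eq)
    also have "\<dots> \<le> e"
    proof (rule LIMSEQ_le_const2)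
      show "(\<lambda>i. rat_padic_abs CARD('p) (?Y i)) \<longlonglongrightarrow> lim (\<lambda>i. rat_padic_abs CARD('p) (?Y i))"
        by (rule tendsto_lim_rat_padic_abs padic_Cauchy_add X padic_Cauchy_const prime_card)+
      show "\<exists>N. \<forall>i\<ge>N. rat_padic_abs CARD('p) (?Y i) \<le> e"
        using k[OF _ that] by (intro exI[of _ k]) (auto intro: less_imp_le)
    qed
    finally show ?thesis .
  qed
  then show ?thesis by blast
qed

lemma padic_of_rat_dense:
  fixes x :: "'p::prime_card padic"
  assumes "e > 0"
  obtains r where "padic_abs (x - padic_of_rat r) < e"
proof -
  obtain X where x: "x = padic_of_seq X"
    using padic.abs_induct[of "\<lambda>x. \<exists>X. x = padic_of_seq X"] by blast
  have "\<exists>r. padic_abs (padic_of_seq X - padic_of_rat r) \<le> e / 2"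
    using padic_of_seq_approx[of "e / 2" X] assms by auto
  then show ?thesis
    using that x assms by (metis field_sum_of_halves less_add_same_cancel1 half_gt_zero le_less_trans)
qed

text \<open>A diagonal argument: each \<open>Y n\<close> is replaced by a rational
  \<open>r n\<close> at distance less than \<open>1 / (n + 1)\<close>. By the ultrametric inequality
  \<open>r\<close> is again Cauchy, and the class of \<open>r\<close> is the limit of
  \<open>Y\<close>.\<close>

lemma complete_padic: "complete (UNIV :: 'p::prime_card padic set)"
  unfolding complete_def
proof (intro allI impI, elim conjE)
  fix Y :: "nat \<Rightarrow> 'p padic"
  assume Y: "Cauchy Y"
  have "\<exists>r. padic_abs (Y n - padic_of_rat r) < inverse (real (Suc n))" for n
    using padic_of_rat_dense[of "inverse (real (Suc n))" "Y n"] by auto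
  then obtain r where r: "\<And>n. padic_abs (Y n - padic_of_rat (r n)) < inverse (real (Suc n))"
    by metis
  have lim: "(\<lambda>n. inverse (real (Suc n))) \<longlonglongrightarrow> 0"
    by (rule LIMSEQ_inverse_real_of_nat)
  have cau: "padic_Cauchy CARD('p) r"
    unfolding padic_Cauchy_def
  proof (intro allI impI)
    fix e :: real assume e: "e > 0"
    from Y e obtain k1 where k1: "\<And>m n. m \<ge> k1 \<Longrightarrow> n \<ge> k1 \<Longrightarrow> padic_abs (Y m - Y n) < e"
      unfolding Cauchy_def dist_padic_def by metis
    from order_tendstoD(2)[OF lim e] obtain k2 where k2: "\<And>n. n \<ge> k2 \<Longrightarrow> inverse (real (Suc n)) < e"
      unfolding eventually_sequentially by blast
    have "rat_padic_abs CARD('p) (r m - r n) < e" if mn: "m \<ge> max k1 k2" "n \<ge> max k1 k2" for m n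
    proof -
      have "padic_of_rat (r m - r n) = (Y m - Y n) + ((Y n - padic_of_rat (r n)) - (Y m - padic_of_rat (r m)))"
        by (simp add: padic_of_rat_diff)
      then have "padic_abs (padic_of_rat (r m - r n) :: 'p padic) =
          padic_abs ((Y m - Y n) + ((Y n - padic_of_rat (r n)) - (Y m - padic_of_rat (r m))))"
        by simp
      also have "\<dots> \<le> max (padic_abs (Y m - Y n)) (padic_abs ((Y n - padic_of_rat (r n)) - (Y m - padic_of_rat (r m))))"
        by (rule padic_abs_ultrametric)
      also have "\<dots> \<le> max (padic_abs (Y m - Y n))
          (max (padic_abs (Y n - padic_of_rat (r n))) (padic_abs (Y m - padic_of_rat (r m))))"
        by (intro max.mono order.refl padic_abs_diff_le)
      also have "\<dots> < e"
        using k1[of m n] k2[of n] k2[of m] r[of m] r[of n] mn by auto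
      finally show ?thesis by (simp add: padic_abs_of_rat)
    qed
    then show "\<exists>k. \<forall>m\<ge>k. \<forall>n\<ge>k. rat_padic_abs CARD('p) (r m - r n) < e" by blast
  qed
  define X :: "'p padic_seq" where "X = Abs_padic_seq r"
  have X: "Rep_padic_seq X = r"
    using cau by (simp add: X_def Abs_padic_seq_inverse)
  have "Y \<longlonglongrightarrow> padic_of_seq X"
  proof (rule metric_LIMSEQ_I)
    fix e :: real assume e: "e > 0"
    from padic_of_seq_approx[of "e/2" X] e obtain k1
      where k1: "\<And>n. n \<ge> k1 \<Longrightarrow> padic_abs (padic_of_seq X - padic_of_rat (r n)) \<le> e / 2"
      unfolding X by (auto simp: X)
    from order_tendstoD(2)[OF lim e] obtain k2 where k2: "\<And>n. n \<ge> k2 \<Longrightarrow> inverse (real (Suc n)) < e"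
      unfolding eventually_sequentially by blast
    have "dist (Y n) (padic_of_seq X) < e" if n: "n \<ge> max k1 k2" for n
    proof -
      have "Y n - padic_of_seq X = (Y n - padic_of_rat (r n)) - (padic_of_seq X - padic_of_rat (r n))"
        by simp
      then have "padic_abs (Y n - padic_of_seq X) \<le>
          max (padic_abs (Y n - padic_of_rat (r n))) (padic_abs (padic_of_seq X - padic_of_rat (r n)))"
        by (metis padic_abs_diff_le)
      also have "\<dots> < e" using k1[of n] k2[of n] r[of n] n e by auto
      finally show ?thesis by (simp add: dist_padic_def)
    qed
    then show "\<exists>k. \<forall>n\<ge>k. dist (Y n) (padic_of_seq X) < e" by blast
  qed
  then show "\<exists>l\<in>UNIV. Y \<longlonglongrightarrow> l" by blast
qed

section \<open>Discrete values and residue digits\<close>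

lemma padic_abs_eq_power_int:
  fixes x :: "'p::prime_card padic"
  assumes "x \<noteq> 0"
  obtains k where "padic_abs x = real CARD('p) powi k"
proof -
  obtain r where r: "padic_abs (x - padic_of_rat r) < padic_abs x"
    using padic_of_rat_dense padic_abs_pos[OF assms] by blast
  \<comment> \<open>A rational closer to \<open>x\<close> than \<open>padic_abs x\<close> has the
    same absolute value, so the completion takes no values beyond those of the rationals.\<close>
  have "padic_abs (padic_of_rat r :: 'p padic) = padic_abs x"
    using padic_abs_isosceles[OF r] by simp
  then have "rat_padic_abs CARD('p) r = padic_abs x"
    by (simp add: padic_abs_of_rat)
  moreover from this have "r \<noteq> 0"
    using padic_abs_pos[OF assms] by auto
  ultimately show ?thesis
    using that by (metis rat_padic_abs_def)
qed

lemma power_int_less_imp_le_minus_1: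
  fixes b :: real
  assumes "b > 1" "b powi k < b powi j"
  shows "b powi k \<le> b powi (j - 1)"
proof -
  have "k < j"
    using assms by (meson linorder_not_le order.strict_implies_order power_int_increasing leD)
  then show ?thesis
    using assms(1) by (intro power_int_increasing) auto
qed

text \<open>Since the nonzero values are integer powers of \<open>p\<close>, an open ball of radius
  \<open>p\<close> to the \<open>j\<close> is the closed ball of the next smaller radius.\<close>

lemma padic_abs_less_iff:
  fixes x :: "'p::prime_card padic"
  shows "padic_abs x < real CARD('p) powi j \<longleftrightarrow> padic_abs x \<le> real CARD('p) powi (j - 1)"
proof
  assume L: "padic_abs x < real CARD('p) powi j"
  show "padic_abs x \<le> real CARD('p) powi (j - 1)"
  proof (cases "x = 0")
    case False
    then obtain k where "padic_abs x = real CARD('p) powi k"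
      using padic_abs_eq_power_int by blast
    then show ?thesis
      using L power_int_less_imp_le_minus_1[OF prime_card_gt_1[where 'p='p]] by metis
  qed simp
next
  assume "padic_abs x \<le> real CARD('p) powi (j - 1)"
  also have "\<dots> < real CARD('p) powi j"
    using prime_card_gt_1[where 'p='p] by (intro power_int_strict_increasing) auto
  finally show "padic_abs x < real CARD('p) powi j" .
qed

text \<open>The residue field is the field with \<open>p\<close> elements: in lowest terms the
  denominator \<open>b\<close> is prime to \<open>p\<close>, and the digit is the numerator times
  the inverse of \<open>b\<close> modulo \<open>p\<close>.\<close>

lemma rat_padic_digit:
  assumes p: "prime p" and r: "rat_padic_abs p r \<le> 1"
  obtains d where "d < p" "rat_padic_abs p (r - of_nat d) < 1"
proof (cases "r = 0")
  case True
  then show ?thesis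
    using that[of 0] prime_gt_0_nat[OF p] by simp
next
  case False
  obtain a b where q: "quotient_of r = (a, b)" by (cases "quotient_of r")
  have ab: "r = of_int a / of_int b" "b > 0" "coprime a b"
    using q quotient_of_div quotient_of_denom_pos quotient_of_coprime by blast+
  have a0: "a \<noteq> 0" using False ab by auto
  have p1: "real p > 1" using prime_gt_1_nat[OF p] by simp
  have le: "multiplicity (int p) b \<le> multiplicity (int p) a"
  proof (rule ccontr)
    assume "\<not> ?thesis"
    then have "real p powi (int (multiplicity (int p) b) - int (multiplicity (int p) a)) > real p powi 0"
      using p1 by (intro power_int_strict_increasing) auto
    then show False
      using r rat_padic_abs_frac[OF p a0, of b] ab by simp
  qed
  \<comment> \<open>If \<open>p\<close> divided \<open>b\<close>, then by \<open>le\<close> it would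
    also divide \<open>a\<close>, against lowest terms.\<close>
  have pb: "\<not> int p dvd b"
  proof
    assume pb: "int p dvd b"
    then have "multiplicity (int p) b > 0"
      using ab p by (simp add: prime_multiplicity_gt_zero_iff)
    then have "int p dvd a"
      using le not_dvd_imp_multiplicity_0 by fastforce
    then show False
      using pb ab(3) p by (meson coprime_common_divisor not_prime_unit prime_nat_int_transfer)
  qed
  then have "coprime b (int p)"
    using p by (metis coprime_commute prime_imp_coprime prime_nat_int_transfer)
  then obtain c where c: "[b * c = 1] (mod (int p))"
    using cong_solve_coprime_int by blast
  define d where "d = nat ((a * c) mod int p)"
  have p0: "int p > 0" using prime_gt_0_nat[OF p] by simp
  have d: "int d = (a * c) mod int p"
    using p0 by (simp add: d_def)
  have "[b * int d = a] (mod (int p))"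
  proof -
    have "[b * int d = b * (a * c)] (mod int p)"
      unfolding d by (intro cong_scalar_left) (simp add: cong_def)
    also have "b * (a * c) = a * (b * c)" by simp
    also have "[a * (b * c) = a * 1] (mod int p)"
      by (rule cong_scalar_left[OF c])
    finally show ?thesis by simp
  qed
  then have dv: "int p dvd a - b * int d"
    by (metis cong_iff_dvd_diff cong_sym)
  have eq: "r - of_nat d = of_int (a - b * int d) / of_int b"
    using ab by (simp add: field_simps)
  have "rat_padic_abs p (r - of_nat d) < 1"
  proof (cases "a - b * int d = 0")
    case True
    then show ?thesis unfolding eq by simp
  next
    case nz: False
    then have "multiplicity (int p) (a - b * int d) > 0"
      using dv p by (simp add: prime_multiplicity_gt_zero_iff)
    moreover have "multiplicity (int p) b = 0"
      using pb by (rule not_dvd_imp_multiplicity_0)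
    ultimately have "real p powi (int (multiplicity (int p) b) - int (multiplicity (int p) (a - b * int d))) < real p powi 0"
      using p1 by (intro power_int_strict_increasing) auto
    then show ?thesis
      unfolding eq using rat_padic_abs_frac[OF p nz, of b] ab by simp
  qed
  moreover have "d < p"
    using d p0 by (metis of_nat_less_iff pos_mod_bound)
  ultimately show ?thesis using that by blast
qed

lemma padic_digit:
  fixes x :: "'p::prime_card padic"
  assumes "padic_abs x \<le> 1"
  obtains d where "d < CARD('p)" "padic_abs (x - of_nat d) < 1"
proof -
  obtain r where r: "padic_abs (x - padic_of_rat r) < 1"
    using padic_of_rat_dense[of 1 x] by auto
  have "padic_abs (padic_of_rat r :: 'p padic) \<le> max (padic_abs x) (padic_abs (x - padic_of_rat r))"
    using padic_abs_diff_le[of x "x - padic_of_rat r"] by simp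
  then have "rat_padic_abs CARD('p) r \<le> 1"
    using assms r by (simp add: padic_abs_of_rat)
  then obtain d where d: "d < CARD('p)" "rat_padic_abs CARD('p) (r - of_nat d) < 1"
    using rat_padic_digit[OF prime_card] by blast
  then have "padic_abs (padic_of_rat r - of_nat d :: 'p padic) < 1"
    by (simp add: padic_of_rat_of_nat[symmetric] padic_of_rat_diff[symmetric] padic_abs_of_rat)
  then have "padic_abs (x - of_nat d) < 1"
    using padic_abs_ultrametric[of "x - padic_of_rat r" "padic_of_rat r - of_nat d"] r by simp
  then show ?thesis using that d by blast
qed

text \<open>Two distinct digits differ by a nonzero integer smaller than \<open>p\<close> in size,
  which \<open>p\<close> cannot divide.\<close>

lemma padic_abs_digit_diff:
  assumes "d < CARD('p)" "d' < CARD('p)" "d \<noteq> d'"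
  shows "padic_abs (of_nat d - of_nat d' :: 'p::prime_card padic) = 1"
proof -
  have "\<not> int CARD('p) dvd int d - int d'"
  proof
    assume "int CARD('p) dvd int d - int d'"
    then have "\<bar>int CARD('p)\<bar> \<le> \<bar>int d - int d'\<bar>"
      using assms(3) by (intro dvd_imp_le_int) auto
    then show False using assms by linarith
  qed
  from rat_padic_abs_of_int_coprime[OF prime_card this]
  have "rat_padic_abs CARD('p) (of_nat d - of_nat d') = 1" by simp
  then show ?thesis
    by (simp add: padic_of_rat_of_nat[symmetric] padic_of_rat_diff[symmetric] padic_abs_of_rat)
qed

section \<open>Decomposition of balls and compactness\<close>

lemma padic_cball: "cball x r = {y. padic_abs (y - x) \<le> r}" for x :: "'p::prime_card padic"
  by (auto simp: cball_def dist_padic_def padic_abs_diff_commute)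

lemma padic_translate_cball: "(+) a ` cball x r = cball (a + x) r" for x :: "'p::prime_card padic"
proof -
  have "y \<in> (+) a ` cball x r" if "y \<in> cball (a + x) r" for y
    using that by (intro image_eqI[of _ _ "y - a"]) (auto simp: padic_cball algebra_simps)
  then show ?thesis by (auto simp: padic_cball)
qed

text \<open>After translation to the origin and scaling by \<open>\<pi> powi (j + 1)\<close> the
  large ball becomes the unit ball, and its \<open>p\<close> pieces become the residue classes of
  the digits.\<close>

lemma padic_cball_split:
  fixes x :: "'p::prime_card padic"
  defines "\<pi> \<equiv> (of_nat CARD('p) :: 'p padic)"
  shows "cball x (real CARD('p) powi (j + 1)) =
         (\<Union>d<CARD('p). cball (x + of_nat d * \<pi> powi (- (j + 1))) (real CARD('p) powi j))" (is ?A)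
    and "disjoint_family_on (\<lambda>d. cball (x + of_nat d * \<pi> powi (- (j + 1))) (real CARD('p) powi j)) {..<CARD('p)}" (is ?B)
proof -
  let ?P = "real CARD('p)"
  have P: "?P > 1" by (rule prime_card_gt_1)
  have pi0: "\<pi> \<noteq> 0"
    using padic_abs_of_card[where 'p='p] P unfolding \<pi>_def by auto
  have abs_pi: "padic_abs (\<pi> powi k) = ?P powi (- k)" for k
    by (simp add: \<pi>_def padic_abs_power_int padic_abs_of_card power_int_inverse power_int_minus)
  \<comment> \<open>Used with \<open>i = 0\<close> for membership in the unit ball and with
    \<open>i = -1\<close> for being in the same residue class.\<close>
  have scale: "padic_abs (z * \<pi> powi (- (j + 1))) \<le> ?P powi (j + 1 + i) \<longleftrightarrow> padic_abs z \<le> ?P powi i" for z i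
    using P by (simp add: padic_abs_mult abs_pi power_int_add[of ?P "j + 1" i] power_int_add)
  show ?A
  proof (intro equalityI subsetI)
    fix y assume y: "y \<in> cball x (?P powi (j + 1))"
    define z where "z = (y - x) * \<pi> powi (j + 1)"
    have yz: "y - x = z * \<pi> powi (- (j + 1))"
      using power_int_add[of \<pi> "j + 1" "- (j + 1)"] pi0 unfolding z_def by (simp add: mult.assoc)
    have "padic_abs z \<le> 1"
      using y scale[of z 0] unfolding padic_cball mem_Collect_eq yz by simp
    then obtain d where d: "d < CARD('p)" "padic_abs (z - of_nat d) < 1"
      using padic_digit by blast
    have "padic_abs (z - of_nat d) \<le> ?P powi (0 - 1)"
      using d padic_abs_less_iff[of "z - of_nat d" 0] by simp
    then have "padic_abs ((z - of_nat d) * \<pi> powi (- (j + 1))) \<le> ?P powi j"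
      using scale[of "z - of_nat d" "-1"] by simp
    moreover have "(z - of_nat d) * \<pi> powi (- (j + 1)) = y - (x + of_nat d * \<pi> powi (- (j + 1)))"
      by (simp only: left_diff_distrib yz[symmetric] diff_diff_eq)
    ultimately show "y \<in> (\<Union>d<CARD('p). cball (x + of_nat d * \<pi> powi (- (j + 1))) (?P powi j))"
      using d by (auto simp: padic_cball)
  next
    fix y assume "y \<in> (\<Union>d<CARD('p). cball (x + of_nat d * \<pi> powi (- (j + 1))) (?P powi j))"
    then obtain d where d: "d < CARD('p)"
        "padic_abs (y - (x + of_nat d * \<pi> powi (- (j + 1)))) \<le> ?P powi j"
      by (auto simp: padic_cball)
    have "rat_padic_abs CARD('p) (of_nat d) \<le> 1"
    proof (cases "d = 0")
      case False
      then show ?thesis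
        using rat_padic_abs_of_int_coprime[OF prime_card, where ?'a1='p, of "int d"] d
        by (auto dest: nat_dvd_not_less)
    qed simp
    then have "padic_abs (of_nat d :: 'p padic) \<le> ?P powi 0"
      by (simp add: padic_of_rat_of_nat[symmetric] padic_abs_of_rat)
    then have "padic_abs (of_nat d * \<pi> powi (- (j + 1))) \<le> ?P powi (j + 1)"
      using scale[of "of_nat d" 0] by simp
    moreover have "?P powi j \<le> ?P powi (j + 1)"
      using P by (intro power_int_increasing) auto
    ultimately have "padic_abs ((y - (x + of_nat d * \<pi> powi (- (j + 1)))) + of_nat d * \<pi> powi (- (j + 1))) \<le> ?P powi (j + 1)"
      using d by (intro order.trans[OF padic_abs_ultrametric]) auto
    then show "y \<in> cball x (?P powi (j + 1))"
      by (simp add: padic_cball)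
  qed
  show ?B
    unfolding disjoint_family_on_def
  proof (intro ballI impI)
    fix d d' assume d: "d \<in> {..<CARD('p)}" "d' \<in> {..<CARD('p)}" "d \<noteq> d'"
    show "cball (x + of_nat d * \<pi> powi (- (j + 1))) (?P powi j) \<inter>
          cball (x + of_nat d' * \<pi> powi (- (j + 1))) (?P powi j) = {}"
    proof (rule ccontr)
      assume "\<not> ?thesis"
      then obtain y where y: "padic_abs (y - (x + of_nat d * \<pi> powi (- (j + 1)))) \<le> ?P powi j"
         "padic_abs (y - (x + of_nat d' * \<pi> powi (- (j + 1)))) \<le> ?P powi j"
        by (auto simp: padic_cball)
      have "(of_nat d - of_nat d') * \<pi> powi (- (j + 1)) =
          (y - (x + of_nat d' * \<pi> powi (- (j + 1)))) - (y - (x + of_nat d * \<pi> powi (- (j + 1))))"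
        by (simp add: algebra_simps)
      also have "padic_abs \<dots> \<le> ?P powi j"
        by (rule order.trans[OF padic_abs_diff_le]) (use y in simp)
      finally have "padic_abs ((of_nat d - of_nat d') * \<pi> powi (- (j + 1))) \<le> ?P powi j" .
      \<comment> \<open>Scaled back, a common point would force the digit difference, whose absolute
        value is \<open>1\<close>, to have absolute value at most \<open>1 / p\<close>.\<close>
      then have "1 \<le> ?P powi (-1)"
        using scale[of "of_nat d - of_nat d'" "-1"] padic_abs_digit_diff[where 'p='p, of d d'] d by simp
      then show False using P by (simp add: power_int_minus field_simps)
    qed
  qed
qed

text \<open>Splitting every ball of the cover \<open>n\<close> times divides the radius by
  \<open>p\<close> at each stage and keeps the number of balls finite.\<close>

lemma padic_totally_bounded:
  fixes x :: "'p::prime_card padic"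
  shows "\<exists>C. finite C \<and> cball x (real CARD('p) powi j) \<subseteq> (\<Union>c\<in>C. cball c (real CARD('p) powi (j - int n)))"
proof (induction n)
  case 0
  then show ?case by (intro exI[of _ "{x}"]) simp
next
  case (Suc n)
  then obtain C where C: "finite C"
    "cball x (real CARD('p) powi j) \<subseteq> (\<Union>c\<in>C. cball c (real CARD('p) powi (j - int n)))" by blast
  define D where "D = (\<Union>c\<in>C. \<Union>d<CARD('p). {c + of_nat d * of_nat CARD('p) powi (- (j - int n))})"
  have "cball c (real CARD('p) powi (j - int n)) \<subseteq> (\<Union>c\<in>D. cball c (real CARD('p) powi (j - int (Suc n))))"
    if "c \<in> C" for c
    using padic_cball_split(1)[of c "j - int (Suc n)"] that unfolding D_def by auto
  with C(2) have "cball x (real CARD('p) powi j) \<subseteq> (\<Union>c\<in>D. cball c (real CARD('p) powi (j - int (Suc n))))"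
    by blast
  moreover have "finite D" using C(1) by (simp add: D_def)
  ultimately show ?case by blast
qed

text \<open>Completeness together with total boundedness. This makes balls admissible in the
  definition of local integrability, which speaks of compact sets.\<close>

lemma compact_padic_cball:
  fixes x :: "'p::prime_card padic"
  shows "compact (cball x (real CARD('p) powi j))"
  unfolding compact_eq_totally_bounded
proof (intro conjI allI impI)
  show "complete (cball x (real CARD('p) powi j))"
    using complete_padic by (rule complete_closed_subset[rotated 2]) auto
  fix e :: real assume e: "e > 0"
  let ?P = "real CARD('p)"
  have P: "?P > 1" by (rule prime_card_gt_1)
  have "(\<lambda>n. ?P powi j * inverse ?P ^ n) \<longlonglongrightarrow> 0"
    using P by (intro tendsto_mult_right_zero LIMSEQ_power_zero) (auto simp: field_simps)
  from order_tendstoD(2)[OF this e] obtain n where n: "?P powi j * inverse ?P ^ n < e"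
    unfolding eventually_sequentially by blast
  have "?P powi (j - int n) < e"
    using n P by (simp add: power_int_diff field_simps)
  then have "cball c (?P powi (j - int n)) \<subseteq> ball c e" for c :: "'p padic"
    by auto
  then show "\<exists>k. finite k \<and> cball x (?P powi j) \<subseteq> (\<Union>x\<in>k. ball x e)"
    using padic_totally_bounded[of x j n] by (meson UN_mono order.refl order.trans)
qed

subsection \<open>Haar measure and radial integrals\<close>

lemma padic_dist_cball_diff:
  fixes x :: "'p::prime_card padic"
  shows "{y. padic_abs (y - x) = real CARD('p) powi j} =
    cball x (real CARD('p) powi j) - cball x (real CARD('p) powi (j - 1))"
  using padic_abs_less_iff[where 'p='p, of _ j] by (force simp: padic_cball not_le)

locale padic_haar_measure =
  fixes M :: "'p::prime_card padic measure" and P :: real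
  assumes haar: "padic_haar M"
  defines "P \<equiv> real CARD('p)"
begin

lemma P_gt_1: "P > 1"
  unfolding P_def by (rule prime_card_gt_1)

lemma sets_M [simp, measurable_cong]: "sets M = sets borel"
  using haar by (simp add: padic_haar_def)

lemma space_M [simp]: "space M = UNIV"
  using sets_eq_imp_space_eq[OF sets_M] by simp

section \<open>Measures of balls, spheres and points\<close>

lemma emeasure_cball_translate: "emeasure M (cball x r) = emeasure M (cball 0 r)"
proof -
  have "cball 0 r \<in> sets M" by simp
  then have "emeasure M ((+) x ` cball 0 r) = emeasure M (cball 0 r)"
    using haar unfolding padic_haar_def by blast
  then show ?thesis by (simp only: padic_translate_cball add_0_right)
qed

text \<open>The ball splits into \<open>p\<close> disjoint smaller balls, all of the same measure by
  translation invariance.\<close>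

lemma emeasure_cball_Suc:
  "emeasure M (cball 0 (P powi (j + 1))) = ennreal P * emeasure M (cball 0 (P powi j))"
proof -
  let ?F = "\<lambda>d::nat. cball (0 + of_nat d * of_nat CARD('p) powi (- (j + 1))) (P powi j) :: 'p padic set"
  have "emeasure M (cball 0 (P powi (j + 1))) = emeasure M (\<Union>d<CARD('p). ?F d)"
    by (simp only: padic_cball_split(1)[where 'p='p, of 0 j] P_def)
  also have "\<dots> = (\<Sum>d<CARD('p). emeasure M (?F d))"
    using padic_cball_split(2)[where 'p='p, of 0 j] unfolding P_def
    by (intro sum_emeasure[symmetric]) auto
  also have "\<dots> = (\<Sum>d<CARD('p). emeasure M (cball 0 (P powi j)))"
    by (rule sum.cong[OF refl emeasure_cball_translate])
  also have "\<dots> = ennreal P * emeasure M (cball 0 (P powi j))"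
    by (simp add: P_def ennreal_of_nat_eq_real_of_nat)
  finally show ?thesis .
qed

lemma emeasure_cball: "emeasure M (cball x (P powi j)) = ennreal (P powi j)"
proof -
  have "emeasure M (cball 0 (P powi j)) = ennreal (P powi j)"
  proof (induction j rule: int_induct[where k = 0])
    case base
    show ?case using haar by (simp add: padic_haar_def padic_cball)
  next
    case (step1 j)
    then show ?case using P_gt_1 emeasure_cball_Suc[of j]
      by (simp add: power_int_add ennreal_mult[symmetric] mult.commute)
  next
    \<comment> \<open>Downwards the recursion is read backwards, cancelling the finite nonzero
      factor \<open>P\<close>.\<close>
    case (step2 j)
    have "ennreal P * ennreal (P powi (j - 1)) = ennreal (P powi j)"
      using P_gt_1 by (simp add: ennreal_mult[symmetric] power_int_diff)
    also have "\<dots> = ennreal P * emeasure M (cball 0 (P powi (j - 1)))"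
      using emeasure_cball_Suc[of "j - 1"] step2 by simp
    finally show ?case
      using P_gt_1 by (simp add: ennreal_mult_cancel_left)
  qed
  then show ?thesis by (simp only: emeasure_cball_translate[of x])
qed

lemma measure_cball: "measure M (cball x (P powi j)) = P powi j"
  using P_gt_1 by (simp add: measure_def emeasure_cball)

lemma sphere_measure:
  fixes x :: "'p padic" and j :: int
  defines "S \<equiv> {y. padic_abs (y - x) = P powi j}"
  shows "S \<in> sets M" "emeasure M S < \<infinity>" "measure M S = (1 - 1 / P) * P powi j"
proof -
  have S: "S = cball x (P powi j) - cball x (P powi (j - 1))"
    unfolding S_def P_def by (rule padic_dist_cball_diff)
  show "S \<in> sets M" unfolding S by auto
  have sub: "cball x (P powi (j - 1)) \<subseteq> cball x (P powi j)"
    using P_gt_1 by (intro subset_cball power_int_increasing) auto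
  have "emeasure M S \<le> emeasure M (cball x (P powi j))"
    unfolding S by (intro emeasure_mono) auto
  then show "emeasure M S < \<infinity>"
    by (simp add: emeasure_cball le_less_trans)
  have "measure M S = measure M (cball x (P powi j)) - measure M (cball x (P powi (j - 1)))"
    unfolding S by (intro measure_Diff sub) (auto simp: emeasure_cball)
  also have "\<dots> = P powi j - P powi (j - 1)"
    by (simp only: measure_cball)
  also have "\<dots> = (1 - 1 / P) * P powi j"
    using P_gt_1 by (simp add: power_int_diff field_simps)
  finally show "measure M S = (1 - 1 / P) * P powi j" .
qed

lemma emeasure_singleton: "emeasure M {x} = 0"
proof -
  have "emeasure M {x} \<le> ennreal (inverse P ^ n)" for n
  proof -
    have "emeasure M {x} \<le> emeasure M (cball x (P powi (- int n)))"
      using P_gt_1 by (intro emeasure_mono) auto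
    then show ?thesis unfolding emeasure_cball by (simp add: power_int_minus power_inverse)
  qed
  moreover have "(\<lambda>n. ennreal (inverse P ^ n)) \<longlonglongrightarrow> ennreal 0"
    using P_gt_1 by (intro tendsto_ennrealI LIMSEQ_power_zero) (auto simp: field_simps)
  ultimately have "emeasure M {x} \<le> ennreal 0"
    by (meson LIMSEQ_le_const)
  then show ?thesis by simp
qed

text \<open>Apart from its centre, the ball is the disjoint union of the spheres of radius
  \<open>R / P ^ i\<close>, on each of which the integrand is constant. Absolute summability
  justifies exchanging series and integral. The centre is arbitrary because \<open>|y - x|\<close>
  will be integrated around a nonzero \<open>x\<close>.\<close>

lemma radial_integral:
  fixes x :: "'p padic" and g :: "real \<Rightarrow> real"
  assumes R: "R = P powi m" and sm: "summable (\<lambda>i. \<bar>g (R / P ^ i) * (R / P ^ i)\<bar>)"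
  shows "set_integrable M (cball x R) (\<lambda>y. g (padic_abs (y - x)))"
    and "(LINT y:cball x R|M. g (padic_abs (y - x))) = (1 - 1 / P) * (\<Sum>i. g (R / P ^ i) * (R / P ^ i))"
proof -
  define S where "S i = {y. padic_abs (y - x) = P powi (m - int i)}" for i :: nat
  define h where "h i y = indicat_real (S i) y * g (R / P ^ i)" for i y
  have Ri: "P powi (m - int i) = R / P ^ i" for i
    using P_gt_1 by (simp add: R power_int_diff)
  have inj: "R / P ^ i = R / P ^ j \<longleftrightarrow> i = j" for i j :: nat
    using P_gt_1 by (auto simp: R divide_simps)
  have S: "S i \<in> sets M" "emeasure M (S i) < \<infinity>" "measure M (S i) = (1 - 1 / P) * (R / P ^ i)" for i
    using sphere_measure[of x "m - int i"] by (simp_all add: S_def Ri)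
  have h_int: "integrable M (h i)" for i
    unfolding h_def using S[of i] by (intro integrable_mult_left) (simp add: integrable_indicator_iff)
  have h_val: "(\<integral>y. h i y \<partial>M) = (1 - 1 / P) * (g (R / P ^ i) * (R / P ^ i))" for i
    unfolding h_def using S[of i] by simp
  have h_norm: "(\<integral>y. norm (h i y) \<partial>M) = (1 - 1 / P) * \<bar>g (R / P ^ i) * (R / P ^ i)\<bar>" for i
  proof -
    have nn: "R / P ^ i \<ge> 0" using P_gt_1 by (simp add: R)
    have "(\<integral>y. norm (h i y) \<partial>M) = (\<integral>y. indicat_real (S i) y * \<bar>g (R / P ^ i)\<bar> \<partial>M)"
      by (simp add: h_def abs_mult)
    moreover from nn have "\<bar>g (R / P ^ i) * (R / P ^ i)\<bar> = \<bar>g (R / P ^ i)\<bar> * (R / P ^ i)"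
      by (simp only: abs_mult abs_of_nonneg)
    ultimately show ?thesis using S[of i] by simp
  qed
  \<comment> \<open>At each point at most one term of the series is nonzero. The centre lies on no
    sphere, so its value \<open>g 0\<close> enters as a separate term supported on a null
    set.\<close>
  have eq: "indicat_real (cball x R) y * g (padic_abs (y - x))
      = (\<Sum>i. h i y) + indicat_real {x} y * g 0" and smh: "summable (\<lambda>i. norm (h i y))" for y
  proof -
    consider "y = x" | "y \<notin> cball x R" | i where "y \<in> S i"
    proof (cases "y = x \<or> y \<notin> cball x R")
      case True
      then show ?thesis using that(1,2) by blast
    next
      case False
      then have "y - x \<noteq> 0" by simp
      then obtain k where k: "padic_abs (y - x) = P powi k"
        unfolding P_def by (rule padic_abs_eq_power_int)
      have "P powi k \<le> P powi m" using False k by (simp add: padic_cball R)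
      then have "k \<le> m"
        using P_gt_1 by (metis linorder_not_le power_int_strict_increasing)
      then have "y \<in> S (nat (m - k))" using k by (simp add: S_def)
      then show ?thesis by (rule that(3))
    qed
    note cs = this
    have nonS: "h i y = 0" if "y \<notin> S i" for i using that by (simp add: h_def)
    have "\<exists>s. (\<lambda>i. norm (h i y)) sums s \<and> (\<lambda>i. h i y) sums (indicat_real (cball x R) y * g (padic_abs (y - x))
        - indicat_real {x} y * g 0)"
      using cs
    proof cases
      case 1
      have "R > 0" using P_gt_1 by (simp add: R)
      have "y \<notin> S i" for i using 1 P_gt_1 by (simp add: S_def)
      then show ?thesis using 1 nonS \<open>R > 0\<close> by (intro exI[of _ 0]) simp
    next
      case 2
      have "R / P ^ i \<le> R" for i
        using P_gt_1 by (simp add: R field_simps)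
      then have "y \<notin> S i" for i using 2 by (auto simp: S_def Ri padic_cball)
      moreover have "R > 0" using P_gt_1 by (simp add: R)
      then have "y \<noteq> x" using 2 by auto
      ultimately show ?thesis using 2 nonS by (intro exI[of _ 0]) simp
    next
      case (3 i)
      have ji: "j = i" if "y \<in> S j" for j using 3 that inj[of i j] by (simp add: S_def Ri)
      have *: "h j y = (if j = i then g (R / P ^ i) else 0)" for j
      proof (cases "j = i")
        case True
        then show ?thesis using 3 by (simp add: h_def)
      next
        case False
        then show ?thesis using ji[of j] nonS[of j] by auto
      qed
      have "R / P ^ i \<le> R" "R / P ^ i > 0"
        using P_gt_1 by (simp_all add: R field_simps)
      then have "y \<in> cball x R" "y \<noteq> x"
        using 3 P_gt_1 by (auto simp: S_def Ri padic_cball)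
      moreover have "padic_abs (y - x) = R / P ^ i" using 3 by (simp add: S_def Ri)
      moreover have "(\<lambda>j. h j y) = (\<lambda>j. if j = i then g (R / P ^ i) else 0)"
          "(\<lambda>j. norm (h j y)) = (\<lambda>j. if j = i then \<bar>g (R / P ^ i)\<bar> else 0)"
        by (intro ext, simp add: *)+
      then have "(\<lambda>j. h j y) sums g (R / P ^ i)" "(\<lambda>j. norm (h j y)) sums \<bar>g (R / P ^ i)\<bar>"
        using sums_single[of i "\<lambda>j. g (R / P ^ i)"] sums_single[of i "\<lambda>j. \<bar>g (R / P ^ i)\<bar>"]
        by (simp_all only:)
      ultimately show ?thesis by (intro exI[of _ "\<bar>g (R / P ^ i)\<bar>"] conjI) simp_all
    qed
    then obtain s where s: "(\<lambda>i. norm (h i y)) sums s"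
      "(\<lambda>i. h i y) sums (indicat_real (cball x R) y * g (padic_abs (y - x)) - indicat_real {x} y * g 0)"
      by blast
    from s(1) show "summable (\<lambda>i. norm (h i y))" by (rule sums_summable)
    from s(2) have "(\<Sum>i. h i y) = indicat_real (cball x R) y * g (padic_abs (y - x)) - indicat_real {x} y * g 0"
      by (rule sums_unique[symmetric])
    then show "indicat_real (cball x R) y * g (padic_abs (y - x))
      = (\<Sum>i. h i y) + indicat_real {x} y * g 0"
      by linarith
  qed
  have sm': "summable (\<lambda>i. \<integral>y. norm (h i y) \<partial>M)"
    unfolding h_norm by (intro summable_mult sm)
  have i1: "integrable M (\<lambda>y. \<Sum>i. h i y)"
    by (intro integrable_suminf h_int sm' AE_I2 smh)
  have i2: "integrable M (\<lambda>y. indicat_real {x} y * g 0)"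
    by (intro integrable_mult_left) (simp add: integrable_indicator_iff emeasure_singleton)
  show "set_integrable M (cball x R) (\<lambda>y. g (padic_abs (y - x)))"
    unfolding set_integrable_def real_scaleR_def eq by (intro Bochner_Integration.integrable_add i1 i2)
  have "(LINT y:cball x R|M. g (padic_abs (y - x))) = (\<integral>y. (\<Sum>i. h i y) \<partial>M) + (\<integral>y. indicat_real {x} y * g 0 \<partial>M)"
    unfolding set_lebesgue_integral_def real_scaleR_def eq by (intro Bochner_Integration.integral_add i1 i2)
  also have "(\<integral>y. indicat_real {x} y * g 0 \<partial>M) = 0"
    by (simp add: measure_def emeasure_singleton)
  also have "(\<integral>y. (\<Sum>i. h i y) \<partial>M) = (\<Sum>i. \<integral>y. h i y \<partial>M)"
    by (intro integral_suminf h_int sm' AE_I2 smh)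
  also have "\<dots> = (1 - 1 / P) * (\<Sum>i. g (R / P ^ i) * (R / P ^ i))"
    unfolding h_val by (rule suminf_mult[OF summable_rabs_cancel[OF sm]])
  finally show "(LINT y:cball x R|M. g (padic_abs (y - x))) = (1 - 1 / P) * (\<Sum>i. g (R / P ^ i) * (R / P ^ i))"
    by simp
qed

end

subsection \<open>Binomial asymptotics of geometric convolutions\<close>

lemma summable_power_mult_geometric:
  fixes q :: real
  assumes "0 < q" "q < 1"
  shows "summable (\<lambda>i. q ^ i * (1 + real i) powr t)"
proof -
  \<comment> \<open>Any ratio strictly between \<open>q\<close> and \<open>1\<close> absorbs the
    power of \<open>1 + i\<close>.\<close>
  define r where "r = (1 + q) / 2"
  have r: "q < r" "r < 1" "0 < r" using assms by (auto simp: r_def)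
  have "(\<lambda>i. q ^ i * (1 + real i) powr t) \<in> O(\<lambda>i. r ^ i)"
    using r assms by real_asymp
  moreover have "summable (\<lambda>i. norm (r ^ i))"
    using r by (simp add: norm_power summable_geometric)
  ultimately show ?thesis by (rule summable_comparison_test_bigo[rotated])
qed

text \<open>The remainder is a tail of the binomial series. Taking out
  \<open>\<bar>z\<bar> ^ Suc K\<close> leaves a series dominated by its absolute version at
  \<open>1 / 2\<close>, inside the radius of convergence; the value of that majorant is
  \<open>C\<close>.\<close>

lemma binomial_taylor_bound:
  fixes s :: real
  obtains C where "C \<ge> 0" "\<And>z. \<bar>z\<bar> \<le> 1 / 2 \<Longrightarrow>
    \<bar>(1 + z) powr s - (\<Sum>k\<le>K. (s gchoose k) * z ^ k)\<bar> \<le> C * \<bar>z\<bar> ^ Suc K"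
proof -
  have "conv_radius (\<lambda>n. s gchoose n) \<ge> 1"
    by (simp add: conv_radius_gchoose)
  moreover have "ereal (norm (1 / 2 :: real)) < 1"
    by simp
  ultimately have "ereal (norm (1 / 2 :: real)) < conv_radius (\<lambda>n. s gchoose n)"
    by (rule less_le_trans[rotated])
  from abs_summable_in_conv_radius[OF this]
  have "summable (\<lambda>n. \<bar>s gchoose n\<bar> * (1 / 2) ^ n)"
    by (simp add: abs_mult power_abs)
  then have "summable (\<lambda>n. \<bar>(s gchoose (n + Suc K))\<bar> * (1 / 2) ^ (n + Suc K))"
    by (subst summable_iff_shift)
  \<comment> \<open>The factor \<open>2 ^ Suc K\<close> cancels the part of the power of
    \<open>1 / 2\<close> whose place \<open>\<bar>z\<bar> ^ Suc K\<close> takes.\<close>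
  then have "summable (\<lambda>n. \<bar>(s gchoose (n + Suc K))\<bar> * (1 / 2) ^ (n + Suc K) * 2 ^ Suc K)"
    by (rule summable_mult2)
  then have sm: "summable (\<lambda>n. \<bar>(s gchoose (n + Suc K))\<bar> * (1 / 2) ^ n)"
    by (simp add: power_add power_one_over)
  define C where "C = (\<Sum>n. \<bar>(s gchoose (n + Suc K))\<bar> * (1 / 2) ^ n)"
  have "C \<ge> 0"
    unfolding C_def by (intro suminf_nonneg sm) auto
  moreover have "\<bar>(1 + z) powr s - (\<Sum>k\<le>K. (s gchoose k) * z ^ k)\<bar> \<le> C * \<bar>z\<bar> ^ Suc K" if z: "\<bar>z\<bar> \<le> 1 / 2" for z
  proof -
    have "(\<lambda>n. (s gchoose n) * z ^ n) sums (1 + z) powr s"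
      using z by (intro gen_binomial_real) auto
    then have "(\<lambda>n. (s gchoose (n + Suc K)) * z ^ (n + Suc K)) sums
        ((1 + z) powr s - (\<Sum>k<Suc K. (s gchoose k) * z ^ k))"
      by (rule sums_split_initial_segment)
    then have eq: "(1 + z) powr s - (\<Sum>k\<le>K. (s gchoose k) * z ^ k)
       = (\<Sum>n. (s gchoose (n + Suc K)) * z ^ (n + Suc K))"
      by (simp add: sums_iff lessThan_Suc_atMost)
    have le: "norm ((s gchoose (n + Suc K)) * z ^ (n + Suc K)) \<le> \<bar>(s gchoose (n + Suc K))\<bar> * (1 / 2) ^ n * \<bar>z\<bar> ^ Suc K" for n
    proof -
      have "\<bar>z\<bar> ^ n \<le> (1 / 2) ^ n" using z by (intro power_mono) auto
      then show ?thesis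
        by (simp only: real_norm_def abs_mult power_abs power_add mult.assoc) (intro mult_left_mono mult_right_mono, auto)
    qed
    have sm2: "summable (\<lambda>n. \<bar>(s gchoose (n + Suc K))\<bar> * (1 / 2) ^ n * \<bar>z\<bar> ^ Suc K)"
      by (rule summable_mult2[OF sm])
    have sm3: "summable (\<lambda>n. norm ((s gchoose (n + Suc K)) * z ^ (n + Suc K)))"
      by (rule summable_comparison_test'[OF sm2, of 0]) (use le in simp)
    have "norm (\<Sum>n. (s gchoose (n + Suc K)) * z ^ (n + Suc K))
        \<le> (\<Sum>n. norm ((s gchoose (n + Suc K)) * z ^ (n + Suc K)))"
      by (rule summable_norm[OF sm3])
    also have "\<dots> \<le> (\<Sum>n. \<bar>(s gchoose (n + Suc K))\<bar> * (1 / 2) ^ n * \<bar>z\<bar> ^ Suc K)"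
      by (rule suminf_le[OF le sm3 sm2])
    also have "\<dots> = C * \<bar>z\<bar> ^ Suc K"
      unfolding C_def by (rule suminf_mult2[OF sm, symmetric])
    finally show ?thesis unfolding eq by simp
  qed
  ultimately show ?thesis using that by blast
qed

text \<open>The sign serves two purposes: \<open>- i\<close> appears when \<open>(1 - i / m)\<close>
  is raised to a power, and it is the exponent of \<open>p\<close> on the sphere of radius
  \<open>1 / P ^ i\<close>. Since \<open>0 ^ 0 = 1\<close>, the moment of order \<open>0\<close> is
  the full geometric series.\<close>

definition geometric_moment :: "real \<Rightarrow> nat \<Rightarrow> real" where
  "geometric_moment q k = (\<Sum>i. q ^ i * (- real i) ^ k)"

lemma summable_abs_geometric_moment:
  fixes q :: real
  assumes "0 < q" "q < 1"
  shows "summable (\<lambda>i. \<bar>q ^ i * (- real i) ^ k\<bar>)"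
proof (rule summable_comparison_test'[OF summable_power_mult_geometric[OF assms, of "real k"], of 0])
  fix i :: nat
  have "real i ^ k \<le> (1 + real i) ^ k" by (intro power_mono) auto
  then show "norm \<bar>q ^ i * (- real i) ^ k\<bar> \<le> q ^ i * (1 + real i) powr real k"
    using assms by (simp add: abs_mult power_abs powr_realpow)
qed

text \<open>A bound uniform in \<open>m\<close>, as Tannery's theorem requires. For
  \<open>s \<ge> 0\<close> the base is at most \<open>1 + i\<close>; for negative \<open>s\<close>
  it is at least \<open>1 / (1 + i)\<close>, because \<open>m - i \<ge> 1\<close> for integers
  \<open>i < m\<close>.\<close>

lemma powr_one_minus_div_le:
  fixes s :: real
  assumes "i < m"
  shows "(1 - real i / real m) powr s \<le> (1 + real i) powr \<bar>s\<bar>"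
proof (cases "s \<ge> 0")
  case True
  have "(1 - real i / real m) powr s \<le> (1 + real i) powr s"
    using assms True by (intro powr_mono2) (auto simp: field_simps)
  with True show ?thesis by simp
next
  case False
  have "real m \<le> (1 + real i) * (real m - real i)"
  proof -
    have "real i * (real m - real i) \<ge> real i * 1"
      using assms by (intro mult_left_mono) auto
    then show ?thesis by (simp add: algebra_simps)
  qed
  then have "inverse (1 + real i) \<le> 1 - real i / real m"
    using assms by (simp add: field_simps)
  then have "(1 - real i / real m) powr s \<le> inverse (1 + real i) powr s"
    using False by (intro powr_mono2') auto
  also have "\<dots> = (1 + real i) powr \<bar>s\<bar>"
    using False by (simp add: inverse_powr powr_minus[symmetric])
  finally show ?thesis .
qed

text \<open>With \<open>m powr s\<close> taken out, the sum runs over \<open>q ^ i\<close> times a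
  power of \<open>1 - i / m\<close>. Subtracting the Taylor polynomial and multiplying by
  \<open>m ^ K\<close> leaves terms that vanish for each fixed \<open>i\<close> and are dominated by
  a polynomially weighted geometric series.\<close>

lemma geometric_convolution_powr_asymptotics:
  fixes q s :: real and K :: nat
  assumes q: "0 < q" "q < 1"
  shows "(\<lambda>m. (\<Sum>i<m. q ^ i * (real m - real i) powr s)
           - (\<Sum>k\<le>K. (s gchoose k) * geometric_moment q k * real m powr (s - real k)))
         \<in> o(\<lambda>m. real m powr (s - real K))"
proof -
  define c where "c k = (s gchoose k)" for k
  obtain C where C: "C \<ge> 0" and
    Cb: "\<And>z. \<bar>z\<bar> \<le> 1 / 2 \<Longrightarrow> \<bar>(1 + z) powr s - (\<Sum>k\<le>K. c k * z ^ k)\<bar> \<le> C * \<bar>z\<bar> ^ Suc K"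
    using binomial_taylor_bound[of s K] unfolding c_def by metis
  define G where "G = (\<Sum>k\<le>K. \<bar>c k\<bar>)"
  have G: "G \<ge> 0" by (auto simp: G_def intro: sum_nonneg)
  \<comment> \<open>Only the power is cut off at \<open>i < m\<close>; the polynomial is subtracted
    for every \<open>i\<close>, so that the sum over all \<open>i\<close> produces complete
    moments.\<close>
  define b where "b i m = (if i < m then (1 - real i / real m) powr s else 0)
      - (\<Sum>k\<le>K. c k * (- (real i / real m)) ^ k)" for i m :: nat
  define a where "a i m = q ^ i * (real m ^ K * b i m)" for i m :: nat
  \<comment> \<open>At \<open>z = - i / m\<close> the Taylor bound gains one power of
    \<open>1 / m\<close> more than \<open>m ^ K\<close> consumes.\<close>
  have small: "real m ^ K * \<bar>b i m\<bar> \<le> C * real i ^ Suc K / real m" if "m > 0" "2 * i \<le> m" for i m :: nat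
  proof -
    have "\<bar>- (real i / real m)\<bar> \<le> 1 / 2" "i < m" using that by (auto simp: field_simps)
    then have "\<bar>b i m\<bar> \<le> C * (real i / real m) ^ Suc K"
      using Cb[of "- (real i / real m)"] by (simp add: b_def)
    then have "real m ^ K * \<bar>b i m\<bar> \<le> real m ^ K * (C * (real i / real m) ^ Suc K)"
      by (intro mult_left_mono) auto
    also have "\<dots> = C * real i ^ Suc K / real m"
      using that by (simp add: power_divide field_simps)
    finally show ?thesis .
  qed
  \<comment> \<open>\<open>D\<close> and \<open>t\<close> are chosen to cover both ranges:
    \<open>C\<close> with exponent \<open>K + 1\<close> for \<open>2 * i \<le> m\<close>, and
    otherwise \<open>2 ^ K\<close> times powers with exponents \<open>K + \<bar>s\<bar>\<close> and
    \<open>2 * K\<close>.\<close>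
  define D where "D = C + 2 ^ K * (1 + G)"
  define t where "t = 2 * real K + 1 + \<bar>s\<bar>"
  have bound: "\<bar>a i m\<bar> \<le> D * (q ^ i * (1 + real i) powr t)" if m: "m > 0" for i m :: nat
  proof -
    have "real m ^ K * \<bar>b i m\<bar> \<le> D * (1 + real i) powr t"
    proof (cases "2 * i \<le> m")
      case True
      have "real m ^ K * \<bar>b i m\<bar> \<le> C * real i ^ Suc K / real m" by (rule small[OF m True])
      also have "\<dots> \<le> C * real i ^ Suc K / 1"
        using m C by (intro divide_left_mono mult_nonneg_nonneg) auto
      also have "\<dots> \<le> C * (1 + real i) ^ Suc K"
        unfolding div_by_1 using C by (intro mult_left_mono power_mono) auto
      also have "(1 + real i) ^ Suc K = (1 + real i) powr real (Suc K)"
        by (subst powr_realpow) auto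
      also have "C * \<dots> \<le> D * (1 + real i) powr t"
        using C G by (intro mult_mono powr_mono) (auto simp: D_def t_def)
      finally show ?thesis .
    next
      case False
      then have i: "i \<ge> 1" by simp
      have "\<bar>b i m\<bar> \<le> \<bar>if i < m then (1 - real i / real m) powr s else 0\<bar>
          + \<bar>\<Sum>k\<le>K. c k * (- (real i / real m)) ^ k\<bar>"
        unfolding b_def by (rule abs_triangle_ineq4)
      also have "\<bar>if i < m then (1 - real i / real m) powr s else 0\<bar> \<le> (1 + real i) powr \<bar>s\<bar>"
        using powr_one_minus_div_le[of i m s] by simp
      also have "\<bar>\<Sum>k\<le>K. c k * (- (real i / real m)) ^ k\<bar> \<le> (\<Sum>k\<le>K. \<bar>c k\<bar> * (1 + real i) ^ K)"
      proof (rule order.trans[OF sum_abs sum_mono])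
        fix k assume k: "k \<in> {..K}"
        have "real i * 1 \<le> (1 + real i) * real m"
          using m by (intro mult_mono) auto
        then have "real i / real m \<le> 1 + real i"
          using m by (simp add: pos_divide_le_eq)
        then have "(real i / real m) ^ k \<le> (1 + real i) ^ k"
          by (intro power_mono) auto
        also have "\<dots> \<le> (1 + real i) ^ K"
          using k by (intro power_increasing) auto
        finally show "\<bar>c k * (- (real i / real m)) ^ k\<bar> \<le> \<bar>c k\<bar> * (1 + real i) ^ K"
          by (simp add: abs_mult power_abs mult_left_mono)
      qed
      also have "(\<Sum>k\<le>K. \<bar>c k\<bar> * (1 + real i) ^ K) = G * (1 + real i) ^ K"
        by (simp add: G_def sum_distrib_right)
      finally have bb: "\<bar>b i m\<bar> \<le> (1 + real i) powr \<bar>s\<bar> + G * (1 + real i) powr real K"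
        by (simp add: powr_realpow)
      \<comment> \<open>Far out in the sum \<open>m < 2 * i\<close>, so powers of \<open>m\<close>
        are paid for by powers of \<open>1 + i\<close>, which \<open>q ^ i\<close> absorbs.\<close>
      have "real m ^ K \<le> (2 * (1 + real i)) ^ K"
        using False by (intro power_mono) auto
      then have "real m ^ K * \<bar>b i m\<bar> \<le> (2 * (1 + real i)) ^ K * ((1 + real i) powr \<bar>s\<bar> + G * (1 + real i) powr real K)"
        using bb by (intro mult_mono) auto
      also have "\<dots> = 2 ^ K * ((1 + real i) powr (real K + \<bar>s\<bar>) + G * (1 + real i) powr (real K + real K))"
      proof -
        have "(2 * (1 + real i)) ^ K = 2 ^ K * (1 + real i) powr real K"
          unfolding power_mult_distrib by (simp add: powr_realpow)
        then show ?thesis by (simp only: powr_add distrib_left mult_ac)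
      qed
      also have "\<dots> \<le> 2 ^ K * ((1 + real i) powr t + G * (1 + real i) powr t)"
        using G by (intro mult_left_mono add_mono powr_mono) (auto simp: t_def)
      also have "\<dots> = (D - C) * (1 + real i) powr t"
        by (simp add: D_def algebra_simps)
      also have "\<dots> \<le> D * (1 + real i) powr t"
        using C by (intro mult_right_mono) auto
      finally show ?thesis .
    qed
    then have "q ^ i * (real m ^ K * \<bar>b i m\<bar>) \<le> q ^ i * (D * (1 + real i) powr t)"
      using q by (intro mult_left_mono) auto
    then show ?thesis using q by (simp add: a_def abs_mult mult_ac)
  qed
  \<comment> \<open>Tannery's theorem: \<open>small\<close> gives the limit of each term, since
    eventually \<open>m > 2 * i\<close>, and \<open>bound\<close> is the summable majorant.\<close>
  have "(\<lambda>m. \<Sum>i. a i m) \<longlonglongrightarrow> (\<Sum>i. 0)"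
  proof (rule tannerys_theorem[THEN conjunct2, THEN conjunct2])
    fix i
    show "(\<lambda>m. a i m) \<longlonglongrightarrow> 0"
    proof (rule Lim_null_comparison)
      have "eventually (\<lambda>m. m > 2 * i) sequentially" by (rule eventually_gt_at_top)
      then show "eventually (\<lambda>m. norm (a i m) \<le> q ^ i * (C * real i ^ Suc K / real m)) sequentially"
      proof eventually_elim
        case (elim m)
        then have "q ^ i * (real m ^ K * \<bar>b i m\<bar>) \<le> q ^ i * (C * real i ^ Suc K / real m)"
          using q by (intro mult_left_mono small) auto
        then show ?case using q by (simp add: a_def abs_mult)
      qed
      show "(\<lambda>m. q ^ i * (C * real i ^ Suc K / real m)) \<longlonglongrightarrow> 0"
        by (intro tendsto_mult_right_zero lim_const_over_n)
    qed
  next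
    show "eventually (\<lambda>(i, m). norm (a i m) \<le> D * (q ^ i * (1 + real i) powr t)) (at_top \<times>\<^sub>F sequentially)"
      using eventually_prodI[OF always_eventually[of "\<lambda>_::nat. True"] eventually_gt_at_top[of "0::nat"], of at_top]
      by (rule eventually_mono) (use bound in auto)
    show "summable (\<lambda>i. D * (q ^ i * (1 + real i) powr t))"
      by (intro summable_mult summable_power_mult_geometric q)
  qed auto
  then have lim: "(\<lambda>m. \<Sum>i. a i m) \<longlonglongrightarrow> 0" by simp
  \<comment> \<open>An exact identity: the finite sum and the moments are written as series and
    combined term by term.\<close>
  have val: "(\<Sum>i<m. q ^ i * (real m - real i) powr s)
           - (\<Sum>k\<le>K. (s gchoose k) * geometric_moment q k * real m powr (s - real k))
        = real m powr (s - real K) * (\<Sum>i. a i m)" if m: "m > 0" for m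
  proof -
    let ?S = "\<Sum>i<m. q ^ i * (1 - real i / real m) powr s"
    have "(\<lambda>i. if i \<in> {..<m} then q ^ i * (1 - real i / real m) powr s else 0) sums ?S"
      by (rule sums_If_finite_set) simp
    moreover have "(\<lambda>i. \<Sum>k\<le>K. c k / real m ^ k * (q ^ i * (- real i) ^ k)) sums (\<Sum>k\<le>K. c k / real m ^ k * geometric_moment q k)"
      unfolding geometric_moment_def by (intro sums_sum sums_mult summable_sums[OF summable_rabs_cancel[OF summable_abs_geometric_moment[OF q]]])
    ultimately have "(\<lambda>i. real m ^ K * ((if i \<in> {..<m} then q ^ i * (1 - real i / real m) powr s else 0)
        - (\<Sum>k\<le>K. c k / real m ^ k * (q ^ i * (- real i) ^ k)))) sums
        (real m ^ K * (?S - (\<Sum>k\<le>K. c k / real m ^ k * geometric_moment q k)))"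
      by (intro sums_mult sums_diff)
    also have "(\<lambda>i. real m ^ K * ((if i \<in> {..<m} then q ^ i * (1 - real i / real m) powr s else 0)
        - (\<Sum>k\<le>K. c k / real m ^ k * (q ^ i * (- real i) ^ k)))) = (\<lambda>i. a i m)"
    proof
      fix i
      have "c k / real m ^ k * (q ^ i * (- real i) ^ k) = q ^ i * (c k * (- (real i / real m)) ^ k)" for k
        using m by (simp add: power_minus[of "real i"] power_minus[of "real i / real m"] power_divide)
      then show "real m ^ K * ((if i \<in> {..<m} then q ^ i * (1 - real i / real m) powr s else 0)
        - (\<Sum>k\<le>K. c k / real m ^ k * (q ^ i * (- real i) ^ k))) = a i m"
        by (simp add: a_def b_def sum_distrib_left right_diff_distrib mult.left_commute[of "real m ^ K" "q ^ i"])
    qed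
    finally have "(\<Sum>i. a i m) = real m ^ K * (?S - (\<Sum>k\<le>K. c k / real m ^ k * geometric_moment q k))"
      by (rule sums_unique[symmetric])
    then have "real m powr (s - real K) * (\<Sum>i. a i m) = real m powr s * (?S - (\<Sum>k\<le>K. c k / real m ^ k * geometric_moment q k))"
      using m by (simp add: powr_diff powr_realpow)
    also have "\<dots> = real m powr s * ?S - (\<Sum>k\<le>K. c k * geometric_moment q k * (real m powr s / real m ^ k))"
      by (simp add: right_diff_distrib sum_distrib_left mult_ac)
    also have "real m powr s * ?S = (\<Sum>i<m. q ^ i * (real m - real i) powr s)"
      unfolding sum_distrib_left
    proof (rule sum.cong[OF refl])
      fix i assume i: "i \<in> {..<m}"
      have "real m powr s * (1 - real i / real m) powr s = (real m * (1 - real i / real m)) powr s"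
        using i by (simp add: powr_mult)
      also have "real m * (1 - real i / real m) = real m - real i"
        using m by (simp add: field_simps)
      finally show "real m powr s * (q ^ i * (1 - real i / real m) powr s) = q ^ i * (real m - real i) powr s"
        by (simp add: mult_ac)
    qed
    also have "(\<Sum>k\<le>K. c k * geometric_moment q k * (real m powr s / real m ^ k)) = (\<Sum>k\<le>K. (s gchoose k) * geometric_moment q k * real m powr (s - real k))"
      using m by (simp add: c_def powr_diff powr_realpow)
    finally show ?thesis by simp
  qed
  show ?thesis
  proof (rule smalloI_tendsto)
    have "eventually (\<lambda>m::nat. m > 0) sequentially" by (rule eventually_gt_at_top)
    then show "eventually (\<lambda>m. real m powr (s - real K) \<noteq> 0) sequentially"
      by eventually_elim simp
    show "(\<lambda>m. ((\<Sum>i<m. q ^ i * (real m - real i) powr s)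
           - (\<Sum>k\<le>K. (s gchoose k) * geometric_moment q k * real m powr (s - real k))) / real m powr (s - real K)) \<longlonglongrightarrow> 0"
    proof (rule Lim_transform_eventually[OF lim])
      from eventually_gt_at_top[of "0::nat"]
      show "eventually (\<lambda>m. (\<Sum>i. a i m) = ((\<Sum>i<m. q ^ i * (real m - real i) powr s)
           - (\<Sum>k\<le>K. (s gchoose k) * geometric_moment q k * real m powr (s - real k))) / real m powr (s - real K)) sequentially"
      proof eventually_elim
        case (elim m)
        then show ?case unfolding val[OF elim] by simp
      qed
    qed
  qed
qed

subsection \<open>The kernel of the fractional integral\<close>

text \<open>At \<open>x = 1\<close> and \<open>b = \<alpha> - 1\<close> this is the bracket in the
  integrand of \<open>padic_Omega\<close>.\<close>

definition padic_kernel :: "real \<Rightarrow> 'p::prime_card padic \<Rightarrow> 'p padic \<Rightarrow> real" where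
  "padic_kernel b x y = padic_abs (x - y) powr b - padic_abs y powr b - padic_abs x powr b"

lemma padic_kernel_less:
  assumes "padic_abs y < padic_abs x"
  shows "padic_kernel b x y = - (padic_abs y powr b)"
  using padic_abs_isosceles[OF assms] by (simp add: padic_kernel_def)

text \<open>Inside the sphere the kernel is minus \<open>|y|\<close> to the power \<open>b\<close>.
  On the sphere \<open>|x - y| \<le> |x|\<close>, so the kernel lies between \<open>-2\<close> and
  \<open>-1\<close> times that power. The bound does not grow with \<open>x\<close>, which keeps the
  contribution of bounded \<open>y\<close> bounded.\<close>

lemma abs_padic_kernel_le:
  assumes "b > 0" "padic_abs y \<le> padic_abs x"
  shows "\<bar>padic_kernel b x y\<bar> \<le> 2 * padic_abs y powr b"
proof (cases "padic_abs y < padic_abs x")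
  case True
  then show ?thesis by (simp add: padic_kernel_less)
next
  case False
  then have eq: "padic_abs y = padic_abs x" using assms by simp
  have "padic_abs (x - y) powr b \<le> padic_abs x powr b"
    using padic_abs_diff_le[of x y] assms eq by (intro powr_mono2) (auto simp: padic_abs_nonneg)
  moreover have "padic_abs (x - y) powr b \<ge> 0" by simp
  ultimately show ?thesis unfolding padic_kernel_def eq by linarith
qed

text \<open>
  With the kernel in this form, \<open>|y - x|\<close> no longer has to be integrated over the sphere
  \<open>|y| = |x|\<close>, only over the ball \<open>|y| \<le> |x|\<close>, which is also a ball around \<open>x\<close>.
\<close>

lemma padic_kernel_times_radial:
  assumes "padic_abs y \<le> padic_abs x"
  shows "padic_kernel b x y * g (padic_abs y) =
    g (padic_abs x) * (padic_abs (y - x) powr b - padic_abs x powr b) - padic_abs y powr b * g (padic_abs y)"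
proof (cases "padic_abs y < padic_abs x")
  case True
  then show ?thesis
    using padic_abs_isosceles[OF True] padic_abs_diff_commute[of x y] by (simp add: padic_kernel_less)
next
  case False
  then have eq: "padic_abs y = padic_abs x" using assms by simp
  then show ?thesis
    by (simp add: padic_kernel_def padic_abs_diff_commute[of x y] algebra_simps)
qed

text \<open>Every point of an ultrametric ball is a centre; hence a function of
  \<open>|y - x|\<close> on the ball about \<open>0\<close> can be integrated as a radial function
  about \<open>x\<close>.\<close>

lemma padic_cball_eq_cball_0:
  fixes x :: "'p::prime_card padic"
  assumes "padic_abs x \<le> r"
  shows "cball x r = cball 0 r"
proof -
  have "padic_abs (y - x) \<le> r \<longleftrightarrow> padic_abs y \<le> r" for y
    using padic_abs_diff_le[of y x] padic_abs_ultrametric[of "y - x" x] assms by auto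
  then show ?thesis by (simp add: padic_cball)
qed

lemma padic_abs_measurable [measurable]:
  "padic_abs \<in> borel_measurable (borel :: 'p::prime_card padic measure)"
  "(\<lambda>y. padic_abs (x - y)) \<in> borel_measurable (borel :: 'p padic measure)"
proof -
  have "(\<lambda>y. dist x y) \<in> borel_measurable (borel :: 'p padic measure)" for x
    by (intro borel_measurable_continuous_onI continuous_intros)
  then show *: "(\<lambda>y. padic_abs (x - y)) \<in> borel_measurable (borel :: 'p padic measure)" for x
    by (simp add: dist_padic_def)
  show "padic_abs \<in> borel_measurable (borel :: 'p padic measure)"
    using *[of 0] by (simp add: padic_abs_minus)
qed

text \<open>
  The cut-off removes the region in which the logarithm is not positive, where \<open>powr\<close> takes junk
  values.
\<close>

definition exterior :: "(real \<Rightarrow> real) \<Rightarrow> real \<Rightarrow> real" where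
  "exterior \<phi> r = (if r > 1 then \<phi> (ln r) / r else 0)"

text \<open>The constant \<open>c0 + 1\<close> is the integral of \<open>|t|\<close> to the power \<open>b\<close> over the unit ball.\<close>

locale padic_haar_exponent = padic_haar_measure M P for M :: "'p::prime_card padic measure" and P +
  fixes b :: real and q :: real and c0 :: real
  assumes b_pos: "b > 0"
  defines "q \<equiv> P powr (- b)"
    and "c0 \<equiv> (1 - 1 / P) * (\<Sum>i. (q / P) ^ i) - 1"
begin

lemma q_bounds: "0 < q" "q < 1"
  using P_gt_1 b_pos by (auto simp: q_def powr_less_one)

section \<open>Kernel integrals of radial functions and the constants \<Omega>\<close>

lemma scale_powr:
  assumes "R > 0"
  shows "(R / P ^ i) powr b = R powr b * q ^ i"
proof -
  have "(P ^ i) powr b = P powr (b * real i)"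
    using P_gt_1 by (simp add: powr_realpow[symmetric] powr_powr mult.commute)
  moreover have "q ^ i = inverse (P powr (b * real i))"
    using P_gt_1 by (simp add: q_def powr_realpow[symmetric] powr_powr powr_minus[symmetric])
  ultimately show ?thesis
    using assms P_gt_1 by (subst powr_divide) (simp_all add: divide_inverse)
qed

lemma kernel_integrable:
  assumes "set_integrable M (cball 0 R) f" "padic_abs x = R"
  shows "set_integrable M (cball 0 R) (\<lambda>y. padic_kernel b x y * f y)"
proof -
  have [measurable]: "(\<lambda>y. indicat_real (cball 0 R) y * f y) \<in> borel_measurable M"
    using assms(1) unfolding set_integrable_def by (auto dest: borel_measurable_integrable)
  have [measurable]: "padic_kernel b x \<in> borel_measurable M"
    unfolding padic_kernel_def by measurable
  have "integrable M (\<lambda>y. padic_kernel b x y * (indicat_real (cball 0 R) y * f y))"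
  proof (rule Bochner_Integration.integrable_bound)
    show "integrable M (\<lambda>y. 2 * R powr b * (indicat_real (cball 0 R) y * f y))"
      using assms(1) unfolding set_integrable_def by (intro integrable_mult_right) simp
    show "AE y in M. norm (padic_kernel b x y * (indicat_real (cball 0 R) y * f y))
        \<le> norm (2 * R powr b * (indicat_real (cball 0 R) y * f y))"
    proof (rule AE_I2)
      fix y
      show "norm (padic_kernel b x y * (indicat_real (cball 0 R) y * f y))
        \<le> norm (2 * R powr b * (indicat_real (cball 0 R) y * f y))"
      proof (cases "y \<in> cball 0 R")
        case True
        then have y: "padic_abs y \<le> R" by (simp add: padic_cball)
        have "\<bar>padic_kernel b x y\<bar> \<le> 2 * padic_abs y powr b"
          using abs_padic_kernel_le[OF b_pos, of y x] y assms(2) by simp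
        also have "\<dots> \<le> 2 * R powr b"
          using y b_pos by (intro mult_left_mono powr_mono2) (auto simp: padic_abs_nonneg)
        finally show ?thesis using True by (simp add: abs_mult mult_right_mono)
      qed simp
    qed
  qed measurable
  then show ?thesis unfolding set_integrable_def by (simp add: mult_ac)
qed

text \<open>By \<open>padic_kernel_times_radial\<close> the integrand splits into a function radial
  about \<open>x\<close>, a constant, and a function radial about \<open>0\<close>. The first two
  are multiples of \<open>g R\<close> and combine to the \<open>c0\<close> term; the third gives the
  series.\<close>

lemma integral_kernel_radial:
  assumes x: "padic_abs x = R" and R: "R = P powi m"
    and sm: "summable (\<lambda>i. \<bar>q ^ i * (g (R / P ^ i) * (R / P ^ i))\<bar>)"
  shows "(LINT y:cball 0 R|M. padic_kernel b x y * g (padic_abs y)) =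
    R powr b * (c0 * (g R * R) - (1 - 1 / P) * (\<Sum>i. q ^ i * (g (R / P ^ i) * (R / P ^ i))))"
proof -
  have R0: "R > 0" using P_gt_1 by (simp add: R)
  have qP: "0 \<le> q / P" "q / P < 1" using q_bounds P_gt_1 by (auto simp: field_simps)
  have e1: "(R / P ^ i) powr b * (R / P ^ i) = R powr b * R * (q / P) ^ i" for i
    by (simp add: scale_powr[OF R0] power_divide)
  have sm1: "summable (\<lambda>i. (q / P) ^ i)" using qP by (intro summable_geometric) auto
  have "summable (\<lambda>i. \<bar>(R / P ^ i) powr b * (R / P ^ i)\<bar>)"
    unfolding e1 using qP R0 sm1 by (simp add: abs_mult)
  note r1 = radial_integral[OF R this, of x]
  have e2: "((R / P ^ i) powr b * g (R / P ^ i)) * (R / P ^ i) = R powr b * (q ^ i * (g (R / P ^ i) * (R / P ^ i)))" for i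
    by (simp add: scale_powr[OF R0] mult_ac)
  have "summable (\<lambda>i. \<bar>((R / P ^ i) powr b * g (R / P ^ i)) * (R / P ^ i)\<bar>)"
    unfolding e2 abs_mult[of "R powr b"] by (intro summable_mult sm)
  note r2 = radial_integral[OF R, of "\<lambda>r. r powr b * g r" 0, OF this]
  have cb: "cball x R = cball 0 R" by (rule padic_cball_eq_cball_0) (simp add: x)
  have fin: "emeasure M (cball 0 R) \<noteq> \<infinity>" unfolding R emeasure_cball by simp
  have i3: "set_integrable M (cball 0 R) (\<lambda>_. R powr b)"
    unfolding set_integrable_def using fin by (intro integrable_scaleR_left) (simp add: integrable_indicator_iff less_top)
  have v3: "(LINT y:cball 0 R|M. R powr b) = R * R powr b"
    using fin by (subst set_integral_const) (simp_all add: R measure_cball)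
  have "(LINT y:cball 0 R|M. padic_kernel b x y * g (padic_abs y)) =
    (LINT y:cball 0 R|M. g R * (padic_abs (y - x) powr b - R powr b) - padic_abs y powr b * g (padic_abs y))"
    by (intro set_lebesgue_integral_cong allI impI)
      (use padic_kernel_times_radial[of _ x b g] x in \<open>auto simp: padic_cball\<close>)
  also have "\<dots> = g R * ((LINT y:cball 0 R|M. padic_abs (y - x) powr b) - R * R powr b)
      - (LINT y:cball 0 R|M. padic_abs y powr b * g (padic_abs y))"
    using r1(1) r2(1) i3 v3 unfolding cb by simp
  also have "(LINT y:cball 0 R|M. padic_abs (y - x) powr b) = (1 - 1 / P) * (R powr b * R * (\<Sum>i. (q / P) ^ i))"
    using r1(2) unfolding cb e1 by (simp only: suminf_mult[OF sm1])
  also have "(LINT y:cball 0 R|M. padic_abs y powr b * g (padic_abs y)) =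
      (1 - 1 / P) * (R powr b * (\<Sum>i. q ^ i * (g (R / P ^ i) * (R / P ^ i))))"
    using r2(2) unfolding e2 diff_zero by (simp only: suminf_mult[OF summable_rabs_cancel[OF sm]])
  finally show ?thesis by (simp add: c0_def algebra_simps)
qed

text \<open>This is the radial formula for \<open>x = 1\<close> and \<open>R = 1\<close> with
  \<open>g r = ln r ^ k / r\<close>. On the sphere of radius \<open>1 / P ^ i\<close> the logarithm
  is \<open>- i * ln P\<close>, whence the moment; the boundary term carries
  \<open>ln 1 ^ k = 0 ^ k\<close> and survives only for \<open>k = 0\<close>.\<close>

lemma padic_Omega_eq: "padic_Omega M k (b + 1) = 0 ^ k * c0 - (1 - 1 / P) * (ln P ^ k * geometric_moment q k)"
proof -
  define g where "g r = ln r ^ k / r" for r :: real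
  have gi: "g (1 / P ^ i) * (1 / P ^ i) = ln P ^ k * (- real i) ^ k" for i
  proof -
    have "ln (1 / P ^ i) = ln P * (- real i)"
      using P_gt_1 by (simp add: ln_div ln_realpow)
    then have "ln (1 / P ^ i) ^ k = ln P ^ k * (- real i) ^ k"
      by (simp only: power_mult_distrib)
    then show ?thesis using P_gt_1 by (simp add: g_def)
  qed
  note abs_sm = summable_abs_geometric_moment[OF q_bounds, of k]
  note sm = summable_rabs_cancel[OF abs_sm]
  have "summable (\<lambda>i. ln P ^ k * \<bar>q ^ i * (- real i) ^ k\<bar>)"
    by (rule summable_mult[OF abs_sm])
  then have sma: "summable (\<lambda>i. \<bar>q ^ i * (g (1 / P ^ i) * (1 / P ^ i))\<bar>)"
    unfolding gi using P_gt_1 by (simp add: abs_mult power_abs mult_ac)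
  have "padic_Omega M k (b + 1) = (LINT y:cball 0 1|M. padic_kernel b 1 y * g (padic_abs y))"
    unfolding padic_Omega_def by (simp add: padic_cball padic_kernel_def g_def)
  also have "\<dots> = 1 powr b * (c0 * (g 1 * 1) - (1 - 1 / P) * (\<Sum>i. q ^ i * (g (1 / P ^ i) * (1 / P ^ i))))"
    by (rule integral_kernel_radial[of _ _ 0]) (simp_all add: sma[simplified])
  also have "(\<Sum>i. q ^ i * (g (1 / P ^ i) * (1 / P ^ i))) = ln P ^ k * geometric_moment q k"
    unfolding gi geometric_moment_def by (subst suminf_mult[OF sm, symmetric]) (simp add: mult_ac)
  also have "g 1 * 1 = 0 ^ k" by (simp add: g_def)
  finally show ?thesis by (simp add: mult_ac)
qed

section \<open>Integrals of cut-off radial functions\<close>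

lemma exterior_scale:
  "exterior \<phi> (P ^ m / P ^ i) * (P ^ m / P ^ i) = (if i < m then \<phi> ((real m - real i) * ln P) else 0)"
proof -
  have "P ^ m / P ^ i > 1 \<longleftrightarrow> i < m"
    using P_gt_1 by (simp add: field_simps)
  moreover have "ln (P ^ m / P ^ i) = (real m - real i) * ln P"
    using P_gt_1 by (simp add: ln_div ln_realpow algebra_simps)
  \<comment> \<open>The factor \<open>1 / r\<close> in \<open>exterior\<close> cancels the radius
    coming from the measure of the sphere, and the cut-off removes all terms with
    \<open>i \<ge> m\<close>.\<close>
  ultimately show ?thesis
    using P_gt_1 by (simp add: exterior_def)
qed

lemma exterior_sums:
  "(\<lambda>i. q ^ i * (exterior \<phi> (P ^ m / P ^ i) * (P ^ m / P ^ i))) sums (\<Sum>i<m. q ^ i * \<phi> ((real m - real i) * ln P))"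
  and exterior_summable: "summable (\<lambda>i. \<bar>q ^ i * (exterior \<phi> (P ^ m / P ^ i) * (P ^ m / P ^ i))\<bar>)"
proof -
  have eq: "q ^ i * (exterior \<phi> (P ^ m / P ^ i) * (P ^ m / P ^ i))
      = (if i \<in> {..<m} then q ^ i * \<phi> ((real m - real i) * ln P) else 0)" for i
    unfolding exterior_scale by simp
  show "(\<lambda>i. q ^ i * (exterior \<phi> (P ^ m / P ^ i) * (P ^ m / P ^ i))) sums (\<Sum>i<m. q ^ i * \<phi> ((real m - real i) * ln P))"
    unfolding eq by (rule sums_If_finite_set) simp
  show "summable (\<lambda>i. \<bar>q ^ i * (exterior \<phi> (P ^ m / P ^ i) * (P ^ m / P ^ i))\<bar>)"
    unfolding eq by (rule summable_finite[of "{..<m}"]) auto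
qed

text \<open>The cut-off makes the series finite. With \<open>m > 0\<close> the outer sphere survives
  the cut-off, so the boundary term is \<open>c0 * \<phi> (real m * ln P)\<close>.\<close>

lemma integral_kernel_exterior:
  assumes x: "padic_abs x = P ^ m" and m: "m > 0"
  shows "(LINT y:cball 0 (P ^ m)|M. padic_kernel b x y * exterior \<phi> (padic_abs y)) =
    (P ^ m) powr b * (c0 * \<phi> (real m * ln P) - (1 - 1 / P) * (\<Sum>i<m. q ^ i * \<phi> ((real m - real i) * ln P)))"
  using integral_kernel_radial[of x "P ^ m" "int m" "exterior \<phi>", OF x _ exterior_summable]
    sums_unique[OF exterior_sums[of \<phi> m]] exterior_scale[of \<phi> m 0] m by simp

lemma exterior_integrable: "set_integrable M (cball 0 (P ^ m)) (\<lambda>y. exterior \<phi> (padic_abs y))"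
proof -
  have "summable (\<lambda>i. \<bar>exterior \<phi> (P ^ m / P ^ i) * (P ^ m / P ^ i)\<bar>)"
    unfolding exterior_scale by (rule summable_finite[of "{..<m}"]) auto
  from radial_integral(1)[of "P ^ m" "int m" "exterior \<phi>" 0, OF _ this] show ?thesis by simp
qed

text \<open>Serves the remainder estimate, where the kernel is replaced by its bound, a multiple of
  \<open>|y|\<close> to the power \<open>b\<close>.\<close>

lemma powr_exterior_integral:
  "set_integrable M (cball 0 (P ^ m)) (\<lambda>y. padic_abs y powr b * exterior \<phi> (padic_abs y))"
  "(LINT y:cball 0 (P ^ m)|M. padic_abs y powr b * exterior \<phi> (padic_abs y))
     = (1 - 1 / P) * ((P ^ m) powr b * (\<Sum>i<m. q ^ i * \<phi> ((real m - real i) * ln P)))"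
proof -
  let ?R = "P ^ m"
  have R0: "?R > 0" using P_gt_1 by simp
  have e: "((?R / P ^ i) powr b * exterior \<phi> (?R / P ^ i)) * (?R / P ^ i)
      = ?R powr b * (q ^ i * (exterior \<phi> (?R / P ^ i) * (?R / P ^ i)))" for i
    by (simp add: scale_powr[OF R0] mult_ac)
  have "summable (\<lambda>i. \<bar>((?R / P ^ i) powr b * exterior \<phi> (?R / P ^ i)) * (?R / P ^ i)\<bar>)"
    unfolding e abs_mult[of "?R powr b"] by (intro summable_mult exterior_summable)
  note r = radial_integral[of ?R "int m" "\<lambda>r. r powr b * exterior \<phi> r" 0, OF _ this]
  show "set_integrable M (cball 0 ?R) (\<lambda>y. padic_abs y powr b * exterior \<phi> (padic_abs y))"
    using r(1) by simp
  show "(LINT y:cball 0 (P ^ m)|M. padic_abs y powr b * exterior \<phi> (padic_abs y))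
     = (1 - 1 / P) * ((P ^ m) powr b * (\<Sum>i<m. q ^ i * \<phi> ((real m - real i) * ln P)))"
    using r(2) unfolding e
    using suminf_mult[OF summable_rabs_cancel[OF exterior_summable], of "?R powr b" \<phi> m]
      sums_unique[OF exterior_sums[of \<phi> m]] by simp
qed

end

subsection \<open>Asymptotic expansion\<close>

context padic_haar_exponent
begin

section \<open>Expansion of the explicit part and estimate of the remainder\<close>

lemma ln_P_pos: "ln P > 0"
  using P_gt_1 by simp

lemma powr_scale_sum:
  "(\<Sum>i<m. q ^ i * ((real m - real i) * ln P) powr s) = ln P powr s * (\<Sum>i<m. q ^ i * (real m - real i) powr s)"
  using ln_P_pos by (simp add: powr_mult sum_distrib_left mult_ac)

text \<open>The expansion of order \<open>K = 0\<close> already shows that the convolution has the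
  order of its leading term.\<close>

lemma geometric_convolution_powr_bound:
  obtains C where "C > 0"
    "eventually (\<lambda>m. (\<Sum>i<m. q ^ i * ((real m - real i) * ln P) powr s) \<le> C * (real m * ln P) powr s) sequentially"
proof -
  let ?S = "\<lambda>m. \<Sum>i<m. q ^ i * (real m - real i) powr s"
  have "(\<lambda>m. ?S m - geometric_moment q 0 * real m powr s) \<in> O(\<lambda>m. real m powr s)"
    using landau_o.small_imp_big[OF geometric_convolution_powr_asymptotics[OF q_bounds, of s 0]] by simp
  moreover have "(\<lambda>m. geometric_moment q 0 * real m powr s) \<in> O(\<lambda>m. real m powr s)"
    by simp
  ultimately have "(\<lambda>m. (?S m - geometric_moment q 0 * real m powr s) + geometric_moment q 0 * real m powr s) \<in> O(\<lambda>m. real m powr s)"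
    by (rule sum_in_bigo)
  then have "?S \<in> O(\<lambda>m. real m powr s)" by simp
  then obtain C where C: "C > 0" "eventually (\<lambda>m. norm (?S m) \<le> C * norm (real m powr s)) sequentially"
    by (rule landau_o.bigE)
  from C(2) have "eventually (\<lambda>m. (\<Sum>i<m. q ^ i * ((real m - real i) * ln P) powr s) \<le> C * (real m * ln P) powr s) sequentially"
  proof eventually_elim
    case (elim m)
    then have "ln P powr s * ?S m \<le> ln P powr s * (C * real m powr s)"
      by (intro mult_left_mono) auto
    also have "\<dots> = C * (real m * ln P) powr s"
      using ln_P_pos by (simp add: powr_mult)
    finally show ?case
      unfolding powr_scale_sum .
  qed
  with C(1) show ?thesis by (rule that)
qed

text \<open>The convolution expansion is multiplied by \<open>- (1 - 1 / P) * ln P powr s\<close>.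
  By \<open>padic_Omega_eq\<close> the moments become the constants \<Omega>, and the extra
  \<open>c0\<close> in the one of order \<open>0\<close> matches the boundary term.\<close>

lemma kernel_moment_asymptotics:
  "(\<lambda>m. c0 * (real m * ln P) powr s - (1 - 1 / P) * (\<Sum>i<m. q ^ i * ((real m - real i) * ln P) powr s)
      - (\<Sum>k\<le>K. (s gchoose k) * padic_Omega M k (b + 1) * (real m * ln P) powr (s - real k)))
    \<in> o(\<lambda>m. (real m * ln P) powr (s - real K))"
proof -
  let ?l = "ln P"
  let ?D = "\<lambda>m. (\<Sum>i<m. q ^ i * (real m - real i) powr s)
           - (\<Sum>k\<le>K. (s gchoose k) * geometric_moment q k * real m powr (s - real k))"
  have "?D \<in> o(\<lambda>m. real m powr (s - real K))"
    by (rule geometric_convolution_powr_asymptotics[OF q_bounds])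
  also have "(\<lambda>m. real m powr (s - real K)) \<in> O(\<lambda>m. (real m * ?l) powr (s - real K))"
  proof (rule bigoI[of _ "inverse (?l powr (s - real K))"])
    show "eventually (\<lambda>m. norm (real m powr (s - real K)) \<le> inverse (?l powr (s - real K)) * norm ((real m * ?l) powr (s - real K))) sequentially"
      using ln_P_pos by (intro always_eventually allI) (simp add: powr_mult field_simps)
  qed
  finally have "(\<lambda>m. (- (1 - 1 / P) * ?l powr s) * ?D m) \<in> o(\<lambda>m. (real m * ?l) powr (s - real K))"
    by (intro cmult_in_smallo_iff[THEN iffD2] disjI2)
  moreover have "(- (1 - 1 / P) * ?l powr s) * ?D m = c0 * (real m * ?l) powr s - (1 - 1 / P) * (\<Sum>i<m. q ^ i * ((real m - real i) * ?l) powr s)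
      - (\<Sum>k\<le>K. (s gchoose k) * padic_Omega M k (b + 1) * (real m * ?l) powr (s - real k))" for m
  proof -
    \<comment> \<open>The power \<open>ln P ^ k\<close> contained in \<Omega> makes the scaling
      factor \<open>ln P powr s\<close> independent of \<open>k\<close>.\<close>
    have l: "?l ^ k * (real m * ?l) powr (s - real k) = ?l powr s * real m powr (s - real k)" for k
      using ln_P_pos by (simp add: powr_mult powr_diff powr_realpow)
    have "(s gchoose k) * padic_Omega M k (b + 1) * (real m * ?l) powr (s - real k)
       = (if k = 0 then c0 * (real m * ?l) powr s else 0)
         - (1 - 1 / P) * ?l powr s * ((s gchoose k) * geometric_moment q k * real m powr (s - real k))" for k
    proof -
      have "(s gchoose k) * padic_Omega M k (b + 1) * (real m * ?l) powr (s - real k)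
        = (s gchoose k) * 0 ^ k * c0 * (real m * ?l) powr (s - real k)
          - (1 - 1 / P) * (s gchoose k) * geometric_moment q k * (?l ^ k * (real m * ?l) powr (s - real k))"
        unfolding padic_Omega_eq by (simp add: algebra_simps)
      also have "(s gchoose k) * 0 ^ k * c0 * (real m * ?l) powr (s - real k) = (if k = 0 then c0 * (real m * ?l) powr s else 0)"
        by (cases k) auto
      finally show ?thesis unfolding l by (simp only: mult_ac)
    qed
    then have "(\<Sum>k\<le>K. (s gchoose k) * padic_Omega M k (b + 1) * (real m * ?l) powr (s - real k))
      = (\<Sum>k\<le>K. if k = 0 then c0 * (real m * ?l) powr s else 0)
        - (1 - 1 / P) * ?l powr s * (\<Sum>k\<le>K. (s gchoose k) * geometric_moment q k * real m powr (s - real k))"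
      by (simp only: sum_subtractf sum_distrib_left)
    also have "(\<Sum>k\<le>K. if k = 0 then c0 * (real m * ?l) powr s else 0) = c0 * (real m * ?l) powr s"
      by (simp add: sum.delta)
    finally have *: "(\<Sum>k\<le>K. (s gchoose k) * padic_Omega M k (b + 1) * (real m * ?l) powr (s - real k))
      = c0 * (real m * ?l) powr s
        - (1 - 1 / P) * ?l powr s * (\<Sum>k\<le>K. (s gchoose k) * geometric_moment q k * real m powr (s - real k))" .
    have "(- u * v) * (S - Z) = w - u * (v * S) - (w - u * v * Z)" for u v w S Z :: real
      by (simp add: algebra_simps)
    then show ?thesis unfolding powr_scale_sum * .
  qed
  ultimately show ?thesis by (simp only:)
qed

text \<open>Terms are collected along the diagonals \<open>j = n + k\<close>. Expanding the term
  with exponent \<open>\<gamma> - n\<close> up to order \<open>N - n\<close> supplies exactly the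
  pairs with \<open>n + k \<le> N\<close>.\<close>

lemma padic_B_rearrange:
  "(\<Sum>n\<le>N. a n * (\<Sum>k\<le>N - n. ((\<gamma> - real n) gchoose k) * padic_Omega M k (b + 1) * L powr (\<gamma> - real n - real k)))
    = (\<Sum>n\<le>N. padic_B M a \<gamma> (b + 1) n * L powr (\<gamma> - real n))"
proof -
  define h where "h k n = a n * (((\<gamma> - real n) gchoose k) * padic_Omega M k (b + 1) * L powr (\<gamma> - real n - real k))" for k n
  have "(\<Sum>n\<le>N. a n * (\<Sum>k\<le>N - n. ((\<gamma> - real n) gchoose k) * padic_Omega M k (b + 1) * L powr (\<gamma> - real n - real k)))
      = (\<Sum>n\<le>N. \<Sum>k\<le>N - n. h k n)"
    by (simp add: h_def sum_distrib_left)
  also have "\<dots> = (\<Sum>(n, k)\<in>(SIGMA n:{..N}. {..N - n}). h k n)"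
    by (rule sum.Sigma) auto
  also have "\<dots> = (\<Sum>(k, n)\<in>{(k, n). k + n \<le> N}. h k n)"
    by (rule sum.reindex_bij_witness[of _ prod.swap prod.swap]) auto
  also have "\<dots> = (\<Sum>j\<le>N. \<Sum>k\<le>j. h k (j - k))"
    by (rule sum.triangle_reindex_eq)
  also have "\<dots> = (\<Sum>n\<le>N. padic_B M a \<gamma> (b + 1) n * L powr (\<gamma> - real n))"
  proof (rule sum.cong[OF refl])
    fix j
    have "h k (j - k) = a (j - k) * ((\<gamma> + real k - real j) gchoose k) * padic_Omega M k (b + 1) * L powr (\<gamma> - real j)"
      if "k \<le> j" for k
    proof -
      have "\<gamma> - real (j - k) = \<gamma> + real k - real j" "\<gamma> - real (j - k) - real k = \<gamma> - real j"
        using that by (simp_all add: of_nat_diff)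
      then show ?thesis by (simp only: h_def mult.assoc)
    qed
    then show "(\<Sum>k\<le>j. h k (j - k)) = padic_B M a \<gamma> (b + 1) j * L powr (\<gamma> - real j)"
      by (simp add: padic_B_def sum_distrib_right)
  qed
  finally show ?thesis .
qed

text \<open>Each exponent \<open>\<gamma> - n\<close> is expanded to order \<open>K = N - n\<close>,
  so that all errors have the same order \<open>\<gamma> - N\<close>; linearity in
  \<open>\<phi>\<close> and the regrouping by diagonals do the rest.\<close>

lemma main_term_asymptotics:
  fixes a :: "nat \<Rightarrow> real" and \<gamma> :: real and N :: nat
  defines "\<phi> \<equiv> \<lambda>t. \<Sum>n\<le>N. a n * t powr (\<gamma> - real n)"
  shows "(\<lambda>m. c0 * \<phi> (real m * ln P) - (1 - 1 / P) * (\<Sum>i<m. q ^ i * \<phi> ((real m - real i) * ln P))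
      - (\<Sum>n\<le>N. padic_B M a \<gamma> (b + 1) n * (real m * ln P) powr (\<gamma> - real n)))
    \<in> o(\<lambda>m. (real m * ln P) powr (\<gamma> - real N))"
proof -
  let ?F = "\<lambda>n m. c0 * (real m * ln P) powr (\<gamma> - real n)
      - (1 - 1 / P) * (\<Sum>i<m. q ^ i * ((real m - real i) * ln P) powr (\<gamma> - real n))
      - (\<Sum>k\<le>N - n. ((\<gamma> - real n) gchoose k) * padic_Omega M k (b + 1) * (real m * ln P) powr (\<gamma> - real n - real k))"
  have "(\<lambda>m. \<Sum>n\<le>N. a n * ?F n m) \<in> o(\<lambda>m. (real m * ln P) powr (\<gamma> - real N))"
  proof (rule big_sum_in_smallo)
    fix n assume n: "n \<in> {..N}"
    have e: "\<gamma> - real n - real (N - n) = \<gamma> - real N" using n by (simp add: of_nat_diff)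
    have "?F n \<in> o(\<lambda>m. (real m * ln P) powr (\<gamma> - real n - real (N - n)))"
      by (rule kernel_moment_asymptotics)
    then show "(\<lambda>m. a n * ?F n m) \<in> o(\<lambda>m. (real m * ln P) powr (\<gamma> - real N))"
      unfolding e by (intro cmult_in_smallo_iff[THEN iffD2] disjI2)
  qed
  moreover have "(\<Sum>n\<le>N. a n * ?F n m) = c0 * \<phi> (real m * ln P) - (1 - 1 / P) * (\<Sum>i<m. q ^ i * \<phi> ((real m - real i) * ln P))
      - (\<Sum>n\<le>N. padic_B M a \<gamma> (b + 1) n * (real m * ln P) powr (\<gamma> - real n))" for m
  proof -
    have 1: "c0 * \<phi> (real m * ln P) = (\<Sum>n\<le>N. a n * (c0 * (real m * ln P) powr (\<gamma> - real n)))"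
      by (simp add: \<phi>_def sum_distrib_left mult_ac)
    have "(\<Sum>i<m. q ^ i * \<phi> ((real m - real i) * ln P)) = (\<Sum>i<m. \<Sum>n\<le>N. a n * (q ^ i * ((real m - real i) * ln P) powr (\<gamma> - real n)))"
      by (simp add: \<phi>_def sum_distrib_left mult_ac)
    also have "\<dots> = (\<Sum>n\<le>N. \<Sum>i<m. a n * (q ^ i * ((real m - real i) * ln P) powr (\<gamma> - real n)))"
      by (rule sum.swap)
    finally have 2: "(1 - 1 / P) * (\<Sum>i<m. q ^ i * \<phi> ((real m - real i) * ln P))
        = (\<Sum>n\<le>N. a n * ((1 - 1 / P) * (\<Sum>i<m. q ^ i * ((real m - real i) * ln P) powr (\<gamma> - real n))))"
      by (simp only: sum_distrib_left mult.left_commute[of "1 - 1 / P"])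
    show ?thesis
      unfolding 1 2 padic_B_rearrange[symmetric] by (simp only: right_diff_distrib sum_subtractf)
  qed
  ultimately show ?thesis by simp
qed

text \<open>The ball is divided at a fixed radius \<open>P ^ m0\<close>. Inside, the kernel is
  bounded independently of \<open>x\<close>, so the contribution is at most a constant
  \<open>A\<close>. Outside, the smallness of \<open>E\<close> reduces the integral to a convolution
  of the required order with a small factor. The bound is uniform over the sphere on which
  \<open>x\<close> lies.\<close>

lemma kernel_error_bound:
  fixes E :: "'p padic \<Rightarrow> real"
  assumes E: "\<And>m. set_integrable M (cball 0 (P ^ m)) E"
    and small: "\<And>e. e > 0 \<Longrightarrow> \<exists>m0. \<forall>y. padic_abs y > P ^ m0 \<longrightarrow> \<bar>E y\<bar> \<le> e * exterior (\<lambda>t. t powr s) (padic_abs y)"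
    and c: "c > 0"
  shows "eventually (\<lambda>m. \<forall>x. padic_abs x = P ^ m \<longrightarrow>
     \<bar>LINT y:cball 0 (P ^ m)|M. padic_kernel b x y * E y\<bar> \<le> c * ((P ^ m) powr b * (real m * ln P) powr s)) sequentially"
proof -
  define W where "W m = (\<Sum>i<m. q ^ i * ((real m - real i) * ln P) powr s)" for m :: nat
  obtain C where C: "C > 0" "eventually (\<lambda>m. W m \<le> C * (real m * ln P) powr s) sequentially"
    using geometric_convolution_powr_bound unfolding W_def by blast
  \<comment> \<open>With this choice \<open>2 * e * C = c / 2\<close>, which leaves the other half
    of \<open>c\<close> for the inner constant \<open>A\<close>.\<close>
  define e where "e = c / (4 * C)"
  have e: "e > 0" using c C by (simp add: e_def)
  from small[OF e] obtain m0 where m0: "\<And>y. padic_abs y > P ^ m0 \<Longrightarrow> \<bar>E y\<bar> \<le> e * exterior (\<lambda>t. t powr s) (padic_abs y)"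
    by blast
  let ?x = "exterior (\<lambda>t. t powr s)"
  define A where "A = 2 * (P ^ m0) powr b * (LINT y:cball 0 (P ^ m0)|M. \<bar>E y\<bar>)"
  \<comment> \<open>Since \<open>b > 0\<close>, exponential growth in \<open>m\<close> beats the
    power of \<open>m * ln P\<close> even when \<open>s\<close> is negative, so the constant
    \<open>A\<close> is eventually absorbed.\<close>
  have "filterlim (\<lambda>m. (P ^ m) powr b * (real m * ln P) powr s) at_top sequentially"
    using P_gt_1 b_pos by real_asymp
  then have "eventually (\<lambda>m. (P ^ m) powr b * (real m * ln P) powr s \<ge> 2 * A / c) sequentially"
    by (simp add: filterlim_at_top)
  with C(2) eventually_ge_at_top[of m0] show ?thesis
  proof eventually_elim
    case (elim m)
    let ?B = "cball 0 (P ^ m) :: 'p padic set"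
    have A: "A \<le> c / 2 * ((P ^ m) powr b * (real m * ln P) powr s)"
      using elim(3) c by (simp add: field_simps)
    have ext_nonneg: "?x r \<ge> 0" for r by (simp add: exterior_def)
    show ?case
    proof (intro allI impI)
      fix x :: "'p padic" assume x: "padic_abs x = P ^ m"
      \<comment> \<open>The first summand majorizes the integrand on the inner ball, the second
        outside it; both are nonnegative, so \<open>G\<close> dominates throughout.\<close>
      define G where "G y = 2 * (P ^ m0) powr b * (indicat_real (cball 0 (P ^ m0)) y * \<bar>E y\<bar>)
          + 2 * e * (padic_abs y powr b * ?x (padic_abs y))" for y
      have sub: "cball 0 (P ^ m0) \<subseteq> ?B"
        using elim(2) P_gt_1 by (intro subset_cball power_increasing) auto
      have ind: "indicat_real ?B y * (indicat_real (cball 0 (P ^ m0)) y * \<bar>E y\<bar>) = indicat_real (cball 0 (P ^ m0)) y * \<bar>E y\<bar>" for y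
        using sub by (auto simp: indicator_def)
      have i1: "set_integrable M ?B (\<lambda>y. indicat_real (cball 0 (P ^ m0)) y * \<bar>E y\<bar>)"
        using set_integrable_abs[OF E[of m0]] unfolding set_integrable_def real_scaleR_def ind .
      have v1: "(LINT y:?B|M. indicat_real (cball 0 (P ^ m0)) y * \<bar>E y\<bar>) = (LINT y:cball 0 (P ^ m0)|M. \<bar>E y\<bar>)"
        unfolding set_lebesgue_integral_def real_scaleR_def ind ..
      note i2 = powr_exterior_integral(1)[of m "\<lambda>t. t powr s"]
      have iG: "set_integrable M ?B G"
        unfolding G_def by (intro set_integral_add(1) set_integrable_mult_right i1 i2)
      have "(LINT y:?B|M. G y) = A + 2 * e * ((1 - 1 / P) * ((P ^ m) powr b * W m))"
        unfolding G_def A_def W_def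
        by (subst set_integral_add(2)) (simp_all add: i1 i2 v1 powr_exterior_integral(2))
      also have "\<dots> \<le> A + 2 * e * (1 * ((P ^ m) powr b * (C * (real m * ln P) powr s)))"
      proof (intro add_left_mono mult_left_mono mult_mono)
        show "0 \<le> (P ^ m) powr b * W m"
          unfolding W_def using q_bounds by (intro mult_nonneg_nonneg sum_nonneg) auto
      qed (use elim(1) e P_gt_1 in auto)
      also have "2 * e * (1 * ((P ^ m) powr b * (C * (real m * ln P) powr s))) = c / 2 * ((P ^ m) powr b * (real m * ln P) powr s)"
        using C(1) by (simp add: e_def field_simps)
      finally have vG: "(LINT y:?B|M. G y) \<le> c * ((P ^ m) powr b * (real m * ln P) powr s)"
        using A by (simp add: field_simps)
      have bnd: "\<bar>padic_kernel b x y * E y\<bar> \<le> G y" if "y \<in> ?B" for y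
      proof -
        have y: "padic_abs y \<le> padic_abs x" using that x by (simp add: padic_cball)
        note K = abs_padic_kernel_le[OF b_pos y]
        show ?thesis
        proof (cases "padic_abs y \<le> P ^ m0")
          case True
          have "\<bar>padic_kernel b x y\<bar> \<le> 2 * (P ^ m0) powr b"
            using K True b_pos powr_mono2[of b "padic_abs y" "P ^ m0"] padic_abs_nonneg[of y] by linarith
          then have "\<bar>padic_kernel b x y * E y\<bar> \<le> 2 * (P ^ m0) powr b * \<bar>E y\<bar>"
            by (simp add: abs_mult mult_right_mono)
          moreover have "2 * e * (padic_abs y powr b * ?x (padic_abs y)) \<ge> 0"
            using e ext_nonneg by simp
          ultimately show ?thesis
            using True by (simp add: G_def padic_cball)
        next
          case False
          then have "\<bar>padic_kernel b x y\<bar> * \<bar>E y\<bar> \<le> (2 * padic_abs y powr b) * (e * ?x (padic_abs y))"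
            using K m0[of y] by (intro mult_mono) auto
          then show ?thesis
            using False by (simp add: G_def padic_cball abs_mult mult_ac)
        qed
      qed
      have iK: "set_integrable M ?B (\<lambda>y. padic_kernel b x y * E y)"
        by (rule kernel_integrable[OF E x])
      have "(LINT y:?B|M. padic_kernel b x y * E y) \<le> (LINT y:?B|M. G y)"
        using bnd by (intro set_integral_mono iK iG) (auto simp: abs_le_iff)
      moreover have "(LINT y:?B|M. - (padic_kernel b x y * E y)) \<le> (LINT y:?B|M. G y)"
        using bnd iK by (intro set_integral_mono iG) (auto simp: abs_le_iff set_integrable_def)
      ultimately have "\<bar>LINT y:?B|M. padic_kernel b x y * E y\<bar> \<le> (LINT y:?B|M. G y)"
        using set_integral_uminus[OF iK] by (simp add: abs_le_iff)
      with vG show "\<bar>LINT y:?B|M. padic_kernel b x y * E y\<bar> \<le> c * ((P ^ m) powr b * (real m * ln P) powr s)"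
        by linarith
    qed
  qed
qed

text \<open>Adding and subtracting \<open>|x|\<close> to the power \<open>b\<close> separates the
  integral of \<open>f\<close> from the kernel, and writing \<open>f\<close> as
  \<open>exterior \<phi>\<close> plus a remainder makes the middle part explicit. Here
  \<open>\<phi>\<close> is arbitrary.\<close>

lemma frac_integrand_split:
  assumes x: "padic_abs x = P ^ m" and m: "m > 0"
    and f: "set_integrable M (cball 0 (P ^ m)) f"
  shows "(LINT y:{y. padic_abs y \<le> padic_abs x}|M. (padic_abs (x - y) powr b - padic_abs y powr b) * f y) =
    (P ^ m) powr b * (LINT y:{y. padic_abs y \<le> padic_abs x}|M. f y) +
    (P ^ m) powr b * (c0 * \<phi> (real m * ln P) - (1 - 1 / P) * (\<Sum>i<m. q ^ i * \<phi> ((real m - real i) * ln P))) +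
    (LINT y:cball 0 (P ^ m)|M. padic_kernel b x y * (f y - exterior \<phi> (padic_abs y)))"
proof -
  let ?B = "cball 0 (P ^ m) :: 'p padic set"
  have B: "{y. padic_abs y \<le> padic_abs x} = ?B" by (simp add: padic_cball x)
  have e: "(\<lambda>y. (padic_abs (x - y) powr b - padic_abs y powr b) * f y)
     = (\<lambda>y. (P ^ m) powr b * f y + (padic_kernel b x y * exterior \<phi> (padic_abs y)
         + padic_kernel b x y * (f y - exterior \<phi> (padic_abs y))))"
    by (simp add: padic_kernel_def x algebra_simps)
  have i: "set_integrable M ?B (\<lambda>y. (P ^ m) powr b * f y)"
    "set_integrable M ?B (\<lambda>y. padic_kernel b x y * exterior \<phi> (padic_abs y))"
    "set_integrable M ?B (\<lambda>y. padic_kernel b x y * (f y - exterior \<phi> (padic_abs y)))"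
    by (intro set_integrable_mult_right kernel_integrable set_integral_diff(1) exterior_integrable f x)+
  show ?thesis
    unfolding B e
    by (subst set_integral_add(2)[OF i(1) set_integral_add(1)[OF i(2,3)]], subst set_integral_add(2)[OF i(2,3)])
       (simp add: integral_kernel_exterior[OF x m])
qed

section \<open>Passage from integer exponents to the limit at infinity\<close>

lemma set_integrable_cball_of_locally:
  assumes "padic_locally_integrable M f"
  shows "set_integrable M (cball 0 (P ^ m)) f"
proof -
  have "compact (cball 0 (P ^ m) :: 'p padic set)"
    using compact_padic_cball[where 'p='p, of 0 "int m"] by (simp add: P_def)
  then show ?thesis using assms by (simp add: padic_locally_integrable_def)
qed

text \<open>Reduces statements about large \<open>x\<close> to statements about large natural
  exponents \<open>m\<close>.\<close>

lemma padic_abs_large_cases: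
  fixes x :: "'p padic"
  assumes "padic_abs x > P ^ k"
  obtains m where "padic_abs x = P ^ m" "m > k"
proof -
  have "x \<noteq> 0"
    using assms P_gt_1 zero_less_power[of P k] by auto
  then obtain j where j: "padic_abs x = P powi j"
    unfolding P_def by (rule padic_abs_eq_power_int)
  have "j > int k"
  proof (rule ccontr)
    assume "\<not> ?thesis"
    then have "P powi j \<le> P powi int k" using P_gt_1 by (intro power_int_increasing) auto
    then show False using assms j by simp
  qed
  then have "padic_abs x = P ^ nat j" "nat j > k" using j by (auto simp: power_int_def)
  then show ?thesis by (rule that)
qed

lemma frac_integral_asymptotics:
  fixes f :: "'p padic \<Rightarrow> real" and a :: "nat \<Rightarrow> real" and \<gamma> :: real and N :: nat
  assumes li: "padic_locally_integrable M f"
    and asym: "(\<lambda>x. f x - inverse (padic_abs x) * (\<Sum>n\<le>N. a n * ln (padic_abs x) powr (\<gamma> - real n)))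
        \<in> o[padic_at_infinity](\<lambda>x. inverse (padic_abs x) * ln (padic_abs x) powr (\<gamma> - real N))"
  shows "(\<lambda>x. padic_frac_integral M (b + 1) f x
           - padic_frac_const CARD('p) (b + 1)
             * (padic_abs x powr b * (LINT y:{y. padic_abs y \<le> padic_abs x}|M. f y)
                + padic_abs x powr b
                  * (\<Sum>n\<le>N. padic_B M a \<gamma> (b + 1) n * ln (padic_abs x) powr (\<gamma> - real n))))
         \<in> o[padic_at_infinity](\<lambda>x. padic_abs x powr b * ln (padic_abs x) powr (\<gamma> - real N))"
proof -
  define s where "s = \<gamma> - real N"
  define \<phi> where "\<phi> t = (\<Sum>n\<le>N. a n * t powr (\<gamma> - real n))" for t
  define E where "E y = f y - exterior \<phi> (padic_abs y)" for y :: "'p padic"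
  define \<kappa> where "\<kappa> = padic_frac_const CARD('p) (b + 1)"
  \<comment> \<open>The error of the explicit part; \<open>E\<close> is the part of \<open>f\<close>
    that the cut-off expansion misses.\<close>
  define U where "U m = c0 * \<phi> (real m * ln P) - (1 - 1 / P) * (\<Sum>i<m. q ^ i * \<phi> ((real m - real i) * ln P))
      - (\<Sum>n\<le>N. padic_B M a \<gamma> (b + 1) n * (real m * ln P) powr (\<gamma> - real n))" for m :: nat
  note f_int = set_integrable_cball_of_locally[OF li]
  have E_int: "set_integrable M (cball 0 (P ^ m)) E" for m
    unfolding E_def by (intro set_integral_diff(1) f_int exterior_integrable)
  have E_small: "\<exists>m0. \<forall>y. padic_abs y > P ^ m0 \<longrightarrow> \<bar>E y\<bar> \<le> e * exterior (\<lambda>t. t powr s) (padic_abs y)"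
    if e: "e > 0" for e
  proof -
    from landau_o.smallD[OF asym e] obtain r where r: "\<And>y. padic_abs y \<ge> r \<Longrightarrow>
        norm (f y - inverse (padic_abs y) * \<phi> (ln (padic_abs y)))
          \<le> e * norm (inverse (padic_abs y) * ln (padic_abs y) powr s)"
      unfolding padic_at_infinity_def eventually_filtercomap_at_top_linorder \<phi>_def s_def by auto
    obtain m0 where m0: "r < P ^ m0"
      using real_arch_pow[OF P_gt_1] by blast
    have "\<bar>E y\<bar> \<le> e * exterior (\<lambda>t. t powr s) (padic_abs y)" if y: "padic_abs y > P ^ m0" for y
    proof -
      \<comment> \<open>Here the cut-off is inactive, so \<open>E y\<close> is the difference
        controlled by the hypothesis on \<open>f\<close>.\<close>
      have "padic_abs y > 1" using y P_gt_1 one_le_power[of P m0] by linarith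
      then show ?thesis
        using r[of y] m0 y by (simp add: E_def exterior_def divide_inverse mult_ac abs_mult)
    qed
    then show ?thesis by blast
  qed
  show ?thesis
    unfolding s_def[symmetric]
  proof (rule landau_o.smallI)
    fix c :: real assume c: "c > 0"
    \<comment> \<open>The errors from \<open>U\<close> and from \<open>E\<close> each use
      \<open>c'\<close>, and both are multiplied by \<open>\<kappa>\<close>; the \<open>+ 1\<close>
      keeps the denominator positive without a case distinction on \<open>\<kappa>\<close>.\<close>
    define c' where "c' = c / (2 * (\<bar>\<kappa>\<bar> + 1))"
    have c': "c' > 0" "2 * \<bar>\<kappa>\<bar> * c' \<le> c"
      using c by (auto simp: c'_def field_simps)
    have "U \<in> o(\<lambda>m. (real m * ln P) powr s)"
      unfolding U_def \<phi>_def s_def by (rule main_term_asymptotics)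
    note U_small = landau_o.smallD[OF this c'(1)]
    have "eventually (\<lambda>m. \<forall>x. padic_abs x = P ^ m \<longrightarrow>
        \<bar>LINT y:cball 0 (P ^ m)|M. padic_kernel b x y * E y\<bar>
         \<le> c' * ((P ^ m) powr b * (real m * ln P) powr s)) sequentially"
      using E_int E_small c'(1) by (rule kernel_error_bound)
    with U_small have "eventually (\<lambda>m. norm (U m) \<le> c' * norm ((real m * ln P) powr s) \<and>
      (\<forall>x. padic_abs x = P ^ m \<longrightarrow> \<bar>LINT y:cball 0 (P ^ m)|M. padic_kernel b x y * E y\<bar>
         \<le> c' * ((P ^ m) powr b * (real m * ln P) powr s))) sequentially"
      by eventually_elim simp
    then obtain m1 where m1: "\<And>m. m \<ge> m1 \<Longrightarrow> norm (U m) \<le> c' * norm ((real m * ln P) powr s)"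
      "\<And>m x. m \<ge> m1 \<Longrightarrow> padic_abs x = P ^ m \<Longrightarrow> \<bar>LINT y:cball 0 (P ^ m)|M. padic_kernel b x y * E y\<bar>
         \<le> c' * ((P ^ m) powr b * (real m * ln P) powr s)"
      unfolding eventually_sequentially by blast
    have "eventually (\<lambda>x :: 'p padic. padic_abs x > P ^ m1) padic_at_infinity"
      unfolding padic_at_infinity_def by (intro eventually_filtercomapI eventually_gt_at_top)
    then show "eventually (\<lambda>x. norm (padic_frac_integral M (b + 1) f x
           - padic_frac_const CARD('p) (b + 1)
             * (padic_abs x powr b * (LINT y:{y. padic_abs y \<le> padic_abs x}|M. f y)
                + padic_abs x powr b
                  * (\<Sum>n\<le>N. padic_B M a \<gamma> (b + 1) n * ln (padic_abs x) powr (\<gamma> - real n))))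
        \<le> c * norm (padic_abs x powr b * ln (padic_abs x) powr s)) padic_at_infinity"
    proof eventually_elim
      case (elim x)
      then obtain m where x: "padic_abs x = P ^ m" and m: "m > m1"
        by (rule padic_abs_large_cases)
      let ?R = "(P ^ m) powr b" and ?L = "(real m * ln P) powr s"
      let ?K = "LINT y:cball 0 (P ^ m)|M. padic_kernel b x y * E y"
      have ln: "ln (padic_abs x) = real m * ln P"
        using P_gt_1 by (simp add: x ln_realpow)
      have "padic_frac_integral M (b + 1) f x = \<kappa> *
          (LINT y:{y. padic_abs y \<le> padic_abs x}|M. (padic_abs (x - y) powr b - padic_abs y powr b) * f y)"
        unfolding padic_frac_integral_def \<kappa>_def add_diff_cancel_right' ..
      also have "\<dots> = \<kappa> * (?R * (LINT y:{y. padic_abs y \<le> padic_abs x}|M. f y)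
          + ?R * (U m + (\<Sum>n\<le>N. padic_B M a \<gamma> (b + 1) n * (real m * ln P) powr (\<gamma> - real n))) + ?K)"
        using frac_integrand_split[OF x _ f_int, of \<phi>] m by (simp add: E_def U_def)
      finally have eq: "padic_frac_integral M (b + 1) f x
           - padic_frac_const CARD('p) (b + 1)
             * (padic_abs x powr b * (LINT y:{y. padic_abs y \<le> padic_abs x}|M. f y)
                + padic_abs x powr b
                  * (\<Sum>n\<le>N. padic_B M a \<gamma> (b + 1) n * ln (padic_abs x) powr (\<gamma> - real n)))
          = \<kappa> * (?R * U m + ?K)"
        unfolding x ln[unfolded x] \<kappa>_def[symmetric] by (simp add: algebra_simps)
      have "\<bar>?R * U m + ?K\<bar> \<le> \<bar>?R * U m\<bar> + \<bar>?K\<bar>"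
        by (rule abs_triangle_ineq)
      also have "\<bar>?R * U m\<bar> \<le> ?R * (c' * ?L)"
        using m1(1)[of m] m by (simp add: abs_mult mult_left_mono)
      also have "\<bar>?K\<bar> \<le> c' * (?R * ?L)"
        using m1(2)[of m x] m x by simp
      finally have "\<bar>\<kappa>\<bar> * \<bar>?R * U m + ?K\<bar> \<le> \<bar>\<kappa>\<bar> * (2 * c' * (?R * ?L))"
        by (intro mult_left_mono) (simp_all add: mult_ac)
      also have "\<dots> = (2 * \<bar>\<kappa>\<bar> * c') * (?R * ?L)" by simp
      also have "\<dots> \<le> c * (?R * ?L)"
        using c'(2) by (intro mult_right_mono) auto
      finally show ?case
        unfolding eq unfolding ln unfolding x by (simp add: abs_mult)
    qed
  qed
qed

end

theorem theorem4:
  fixes M :: "'p::prime_card padic measure"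
    and f :: "'p padic \<Rightarrow> real"
    and a :: "nat \<Rightarrow> real"
    and \<alpha> \<gamma> :: real
  assumes "padic_haar M"
    and "\<alpha> > 1" and "\<gamma> \<ge> 0"
    and "\<And>x. f x \<ge> 0"
    and "padic_locally_integrable M f"
    and "\<And>N. (\<lambda>x. f x - inverse (padic_abs x)
                      * (\<Sum>n\<le>N. a n * ln (padic_abs x) powr (\<gamma> - real n)))
              \<in> o[padic_at_infinity](\<lambda>x. inverse (padic_abs x) * ln (padic_abs x) powr (\<gamma> - real N))"
  shows "\<forall>N. (\<lambda>x. padic_frac_integral M \<alpha> f x
                - padic_frac_const CARD('p) \<alpha>
                  * (padic_abs x powr (\<alpha> - 1) * (LINT y:{y. padic_abs y \<le> padic_abs x}|M. f y)
                     + padic_abs x powr (\<alpha> - 1)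
                       * (\<Sum>n\<le>N. padic_B M a \<gamma> \<alpha> n * ln (padic_abs x) powr (\<gamma> - real n))))
              \<in> o[padic_at_infinity](\<lambda>x. padic_abs x powr (\<alpha> - 1) * ln (padic_abs x) powr (\<gamma> - real N))"
proof
  fix N
  \<comment> \<open>The exponent is \<open>b = \<alpha> - 1\<close>, with \<open>q\<close> and
    \<open>c0\<close> given by their defining expressions; \<open>b + 1\<close> then simplifies to
    \<open>\<alpha>\<close>.\<close>
  interpret padic_haar_exponent M "real CARD('p)" "\<alpha> - 1" "real CARD('p) powr (- (\<alpha> - 1))"
    "(1 - 1 / real CARD('p)) * (\<Sum>i. (real CARD('p) powr (- (\<alpha> - 1)) / real CARD('p)) ^ i) - 1"
    by unfold_locales (use assms in simp_all)
  from frac_integral_asymptotics[OF assms(5) assms(6)[of N]]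
  show "(\<lambda>x. padic_frac_integral M \<alpha> f x
                - padic_frac_const CARD('p) \<alpha>
                  * (padic_abs x powr (\<alpha> - 1) * (LINT y:{y. padic_abs y \<le> padic_abs x}|M. f y)
                     + padic_abs x powr (\<alpha> - 1)
                       * (\<Sum>n\<le>N. padic_B M a \<gamma> \<alpha> n * ln (padic_abs x) powr (\<gamma> - real n))))
              \<in> o[padic_at_infinity](\<lambda>x. padic_abs x powr (\<alpha> - 1) * ln (padic_abs x) powr (\<gamma> - real N))"
    by simp
qed

end
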